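(* Let $K$ be any field and $\mathbf A=\operatorname{Alg}(v_0,v_1)$. The growth of $\mathbf A$ is quadratic, namely: (i) there exist constants $c_1,c_2,c_3,c_4>0$ such that (a) $c_1m^2\le\tilde\gamma_{\mathbf A}(m)\le c_2m^2$ for all $m\ge 1$ (weight growth function); (b) $c_3m^2\le\gamma_{\mathbf A}(m)\le c_4m^2$ for all $m\ge 1$ (ordinary growth function); (ii) $\operatorname{GKdim}\mathbf A=\underline{\operatorname{GKdim}}\,\mathbf A=2$.
   Context: Let $\Lambda=\Lambda(x_i\mid i\ge 0)$ be the Grassmann (exterior) algebra over $K$ on odd generators $x_0,x_1,\dots$, a $\mathbb Z_2$-graded algebra. In $\operatorname{End}\Lambda$ identify $x_i$ with left multiplication by $x_i$, and let $\partial_i$ be the odd superderivation of $\Lambda$ with $\partial_i(x_j)=\delta_{ij}$ (so $\partial_i(ab)=\partial_i(a)b+(-1)^{\deg a}a\,\partial_i(b)$). The pivot elements are the odd superderivations $v_i=\partial_i+x_ix_{i+1}(\partial_{i+2}+x_{i+2}x_{i+3}(\partial_{i+4}+\cdots))$, $i\ge 0$, that is, $v_i=\partial_i+x_ix_{i+1}v_{i+2}$ (well defined on $\Lambda$, since each element involves finitely many letters). $\mathbf A=\operatorname{Alg}(v_0,v_1)$ is the associative subalgebra (without unit) of $\operatorname{End}\Lambda$ generated by $v_0,v_1$. $\gamma_{\mathbf A}(m)$ is the dimension of the span of all associative monomials in $v_0,v_1$ of length at most $m$; $\tilde\gamma_{\mathbf A}(m)$ is the dimension of the span of all associative monomials in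 $v_0,v_1$ of total weight at most $m$, where $\operatorname{wt}(v_0)=1$, $\operatorname{wt}(v_1)=2$ and weights add. $\operatorname{GKdim}\mathbf A=\limsup_{n\to\infty}\ln\gamma_{\mathbf A}(n)/\ln n$ and $\underline{\operatorname{GKdim}}\,\mathbf A=\liminf_{n\to\infty}\ln\gamma_{\mathbf A}(n)/\ln n$. *)

theory Defs
  imports
    Complex_Main
    "HOL-Library.Function_Algebras"
    "HOL-Library.Groups_Big_Fun"
    "HOL-Library.Extended_Real"
begin

section \<open>The Grassmann algebra on \<open>x\<^sub>0, x\<^sub>1, \<dots>\<close>\<close>

text \<open>
  An element is given by its coefficients with respect to the standard basis
  \<open>x\<^sub>A = x\<^bsub>a1\<^esub> \<cdots> x\<^bsub>ar\<^esub>\<close>, where \<open>A = {a1 < \<cdots> < ar}\<close> ranges over the finite sets of naturals.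
\<close>

typedef (overloaded) ('k::zero) grassmann =
    "{f :: nat set \<Rightarrow> 'k. finite {A. f A \<noteq> 0} \<and> (\<forall>A. f A \<noteq> 0 \<longrightarrow> finite A)}"
  morphisms gcoeff Abs_grassmann
  by (rule exI[of _ "\<lambda>_. 0"]) simp

setup_lifting type_definition_grassmann

text \<open>
  For disjoint \<open>A\<close> and \<open>B\<close> we have \<open>x\<^sub>A x\<^sub>B = gsign A B \<cdot> x\<^bsub>A \<union> B\<^esub>\<close>: one factor \<open>-1\<close> for every
  inversion; for non-disjoint \<open>A\<close> and \<open>B\<close> the product is \<open>0\<close>.
\<close>

definition gsign :: "nat set \<Rightarrow> nat set \<Rightarrow> 'k::comm_ring_1" where
  "gsign A B = (\<Prod>a\<in>A. \<Prod>b\<in>B. if b < a then - 1 else 1)"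

lemma gsign_empty [simp]: "gsign {} B = 1" "gsign A {} = 1"
  by (simp_all add: gsign_def)

lemma gsign_Un_left:
  "finite A \<Longrightarrow> finite B \<Longrightarrow> A \<inter> B = {} \<Longrightarrow> gsign (A \<union> B) C = gsign A C * gsign B C"
  by (simp add: gsign_def prod.union_disjoint)

lemma gsign_Un_right:
  "finite B \<Longrightarrow> finite C \<Longrightarrow> B \<inter> C = {} \<Longrightarrow> gsign A (B \<union> C) = gsign A B * gsign A C"
  by (simp add: gsign_def prod.union_disjoint prod.distrib)

lemma gsign_insert_left:
  "finite A \<Longrightarrow> i \<notin> A \<Longrightarrow> gsign (insert i A) C = gsign {i} C * gsign A C"
  by (simp add: gsign_def)

lemma gsign_insert_right:
  "finite C \<Longrightarrow> i \<notin> C \<Longrightarrow> gsign A (insert i C) = gsign A {i} * gsign A C"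
  by (simp add: gsign_def prod.distrib)

lemma gsign_square [simp]: "gsign A B * gsign A B = 1"
  unfolding gsign_def prod.distrib[symmetric] by (intro prod.neutral ballI) simp

lemma gsign_square' [simp]: "gsign A B * (gsign A B * c) = c"
  by (simp flip: mult.assoc)

lemma gsign_swap:
  assumes "finite A" "i \<notin> A"
  shows "gsign {i} A * gsign A {i} = (- 1) ^ card A"
proof -
  have "gsign {i} A * gsign A {i} =
      (\<Prod>a\<in>A. (if a < i then - 1 else 1) * (if i < a then - 1 else 1) :: 'a)"
    by (simp add: gsign_def prod.distrib)
  also have "\<dots> = (\<Prod>a\<in>A. - 1)"
  proof (intro prod.cong refl)
    fix a assume "a \<in> A"
    with assms have "a < i \<or> i < a" by (metis linorder_neqE_nat)
    thus "(if a < i then - 1 else 1) * (if i < a then - 1 else 1) = (- 1 :: 'a)" by auto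
  qed
  finally show ?thesis by simp
qed

instantiation grassmann :: (comm_ring_1) ring_1
begin

lift_definition zero_grassmann :: "'a grassmann" is "\<lambda>_. 0" by simp

lift_definition one_grassmann :: "'a grassmann" is "\<lambda>A. if A = {} then 1 else 0" by auto

lift_definition plus_grassmann :: "'a grassmann \<Rightarrow> 'a grassmann \<Rightarrow> 'a grassmann"
  is "\<lambda>f g A. f A + g A"
proof -
  fix f g :: "nat set \<Rightarrow> 'a"
  assume f: "finite {A. f A \<noteq> 0} \<and> (\<forall>A. f A \<noteq> 0 \<longrightarrow> finite A)"
    and g: "finite {A. g A \<noteq> 0} \<and> (\<forall>A. g A \<noteq> 0 \<longrightarrow> finite A)"
  have "{A. f A + g A \<noteq> 0} \<subseteq> {A. f A \<noteq> 0} \<union> {A. g A \<noteq> 0}" by auto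
  hence "finite {A. f A + g A \<noteq> 0}"
    using conjunct1[OF f] conjunct1[OF g] by (meson finite_UnI finite_subset)
  moreover have "finite A" if "f A + g A \<noteq> 0" for A
    using that conjunct2[OF f] conjunct2[OF g] by (cases "f A = 0") auto
  ultimately show "finite {A. f A + g A \<noteq> 0} \<and> (\<forall>A. f A + g A \<noteq> 0 \<longrightarrow> finite A)" by blast
qed

lift_definition uminus_grassmann :: "'a grassmann \<Rightarrow> 'a grassmann" is "\<lambda>f A. - f A" by simp

definition minus_grassmann :: "'a grassmann \<Rightarrow> 'a grassmann \<Rightarrow> 'a grassmann" where
  "minus_grassmann f g = f + - g"

text \<open>For infinite \<open>C\<close> the sum below ranges over an infinite set and hence is \<open>0\<close>.\<close>

lift_definition times_grassmann :: "'a grassmann \<Rightarrow> 'a grassmann \<Rightarrow> 'a grassmann"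
  is "\<lambda>f g C. \<Sum>A\<in>Pow C. gsign A (C - A) * f A * g (C - A)"
proof -
  fix f g :: "nat set \<Rightarrow> 'a"
  assume f: "finite {A. f A \<noteq> 0} \<and> (\<forall>A. f A \<noteq> 0 \<longrightarrow> finite A)"
    and g: "finite {A. g A \<noteq> 0} \<and> (\<forall>A. g A \<noteq> 0 \<longrightarrow> finite A)"
  let ?h = "\<lambda>C. \<Sum>A\<in>Pow C. gsign A (C - A) * f A * g (C - A)"
  have "{C. ?h C \<noteq> 0} \<subseteq> (\<lambda>(A, B). A \<union> B) ` ({A. f A \<noteq> 0} \<times> {B. g B \<noteq> 0})"
  proof
    fix C assume "C \<in> {C. ?h C \<noteq> 0}"
    hence "?h C \<noteq> 0" by simp
    then obtain A where A: "A \<in> Pow C" "gsign A (C - A) * f A * g (C - A) \<noteq> 0"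
      by (rule sum.not_neutral_contains_not_neutral)
    from A(2) have "f A \<noteq> 0" by (metis mult_zero_left mult_zero_right)
    moreover from A(2) have "g (C - A) \<noteq> 0" by (metis mult_zero_right)
    moreover from A(1) have "C = A \<union> (C - A)" by blast
    ultimately show "C \<in> (\<lambda>(A, B). A \<union> B) ` ({A. f A \<noteq> 0} \<times> {B. g B \<noteq> 0})"
      by (intro image_eqI[of _ _ "(A, C - A)"]) simp_all
  qed
  moreover have "finite ((\<lambda>(A, B). A \<union> B) ` ({A. f A \<noteq> 0} \<times> {B. g B \<noteq> 0}))"
    using conjunct1[OF f] conjunct1[OF g] by (intro finite_imageI finite_cartesian_product)
  ultimately have "finite {C. ?h C \<noteq> 0}" by (rule finite_subset)
  moreover have "finite C" if "?h C \<noteq> 0" for C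
  proof (rule ccontr)
    assume "infinite C"
    hence "?h C = 0" by (intro sum.infinite) simp
    with that show False by contradiction
  qed
  ultimately show "finite {C. ?h C \<noteq> 0} \<and> (\<forall>C. ?h C \<noteq> 0 \<longrightarrow> finite C)" by blast
qed

lemma gmult_assoc_aux:
  fixes f g h :: "nat set \<Rightarrow> 'a"
  assumes C: "finite C"
  shows "(\<Sum>A\<in>Pow C. gsign A (C - A) * (\<Sum>B\<in>Pow A. gsign B (A - B) * f B * g (A - B)) * h (C - A))
       = (\<Sum>B\<in>Pow C. gsign B (C - B) * f B *
            (\<Sum>D\<in>Pow (C - B). gsign D (C - B - D) * g D * h (C - B - D)))" (is "?L = ?R")
proof -
  have fin: "finite A" if "A \<subseteq> C" for A using that C finite_subset by blast
  have "?L = (\<Sum>(A,B)\<in>(SIGMA A:Pow C. Pow A).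
      gsign A (C - A) * (gsign B (A - B) * f B * g (A - B)) * h (C - A))"
    using C fin by (simp add: sum_distrib_left sum_distrib_right sum.Sigma)
  also have "\<dots> = (\<Sum>(B,D)\<in>(SIGMA B:Pow C. Pow (C - B)).
      gsign B (C - B) * f B * (gsign D (C - B - D) * g D * h (C - B - D)))"
  proof (rule sum.reindex_bij_witness[of _ "\<lambda>(B,D). (B \<union> D, B)" "\<lambda>(A,B). (B, A - B)"], goal_cases)
    case (5 p)
    obtain A B where p: "p = (A, B)" by fastforce
    with 5 have AB: "A \<subseteq> C" "B \<subseteq> A" by auto
    let ?D = "A - B" and ?E = "C - A"
    have finE: "finite ?E" "finite ?D" "finite B" using AB fin C by auto
    have "A = B \<union> ?D" "C - B = ?D \<union> ?E" "C - B - ?D = ?E" using AB by auto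
    moreover have "gsign (B \<union> ?D) ?E = (gsign B ?E * gsign ?D ?E :: 'a)"
      using finE by (intro gsign_Un_left) auto
    moreover have "gsign B (?D \<union> ?E) = (gsign B ?D * gsign B ?E :: 'a)"
      using finE by (intro gsign_Un_right) auto
    ultimately have eq: "gsign A ?E * gsign B ?D = (gsign B (C - B) * gsign ?D ?E :: 'a)" and E: "C - B - ?D = ?E"
      by (simp_all only: ac_simps)
    have "gsign B (C - B) * f B * (gsign ?D ?E * g ?D * h ?E)
        = (gsign B (C - B) * gsign ?D ?E) * (f B * g ?D * h ?E)"
      by (simp only: ac_simps)
    also have "\<dots> = gsign A ?E * (gsign B ?D * f B * g ?D) * h ?E"
      by (simp only: eq[symmetric] ac_simps)
    finally show ?case by (simp only: p prod.case E)
  qed auto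
  also have "\<dots> = ?R"
    using C fin by (simp add: sum_distrib_left sum.Sigma)
  finally show ?thesis .
qed

instance
proof
  fix a b c :: "'a grassmann"
  show "a * b * c = a * (b * c)"
  proof (transfer, rule ext, goal_cases)
    case (1 f g h C)
    show ?case
    proof (cases "finite C")
      case True
      thus ?thesis by (rule gmult_assoc_aux)
    qed simp
  qed
  show "1 * a = a"
  proof (transfer, rule ext, goal_cases)
    case (1 f C)
    show ?case
    proof (cases "finite C")
      case True
      have "(\<Sum>A\<in>Pow C. gsign A (C - A) * (if A = {} then 1 else 0) * f (C - A))
          = (\<Sum>A\<in>Pow C. if A = {} then f C else 0)"
        by (intro sum.cong) auto
      thus ?thesis using True by simp
    next
      case False
      thus ?thesis using 1 by auto
    qed
  qed
  show "a * 1 = a"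
  proof (transfer, rule ext, goal_cases)
    case (1 f C)
    show ?case
    proof (cases "finite C")
      case True
      have "(\<Sum>A\<in>Pow C. gsign A (C - A) * f A * (if C - A = {} then 1 else 0))
          = (\<Sum>A\<in>Pow C. if A = C then f C else 0)"
        by (intro sum.cong) auto
      thus ?thesis using True by simp
    next
      case False
      thus ?thesis using 1 by auto
    qed
  qed
  show "(a + b) * c = a * c + b * c"
    by transfer (simp add: algebra_simps sum.distrib fun_eq_iff)
  show "a * (b + c) = a * b + a * c"
    by transfer (simp add: algebra_simps sum.distrib fun_eq_iff)
  show "(0::'a grassmann) \<noteq> 1"
    by transfer (metis zero_neq_one)
  show "a - b = a + - b" by (rule minus_grassmann_def)
  show "a + b = b + a" by transfer (simp add: ac_simps)
  show "a + b + c = a + (b + c)" by transfer (simp add: ac_simps)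
  show "0 + a = a" by transfer simp
  show "- a + a = 0" by transfer simp
qed

end

lift_definition gscale :: "'k::comm_ring_1 \<Rightarrow> 'k grassmann \<Rightarrow> 'k grassmann" (infixr "*\<^sub>G" 75)
  is "\<lambda>c f A. c * f A"
proof -
  fix c :: 'k and f :: "nat set \<Rightarrow> 'k"
  assume f: "finite {A. f A \<noteq> 0} \<and> (\<forall>A. f A \<noteq> 0 \<longrightarrow> finite A)"
  have "{A. c * f A \<noteq> 0} \<subseteq> {A. f A \<noteq> 0}" by auto
  hence "finite {A. c * f A \<noteq> 0}" using conjunct1[OF f] by (rule finite_subset)
  moreover have "finite A" if "c * f A \<noteq> 0" for A
    using that conjunct2[OF f] by (cases "f A = 0") auto
  ultimately show "finite {A. c * f A \<noteq> 0} \<and> (\<forall>A. c * f A \<noteq> 0 \<longrightarrow> finite A)" by blast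
qed

interpretation grassmann: vector_space "gscale :: 'k::field \<Rightarrow> _"
  by unfold_locales (transfer; simp add: algebra_simps fun_eq_iff)+

lemma gscale_mult_left: "(c *\<^sub>G a) * b = c *\<^sub>G (a * b)"
  by transfer (simp add: sum_distrib_left ac_simps fun_eq_iff)

lemma gscale_mult_right: "a * (c *\<^sub>G b) = c *\<^sub>G (a * b)"
  by transfer (simp add: sum_distrib_left ac_simps fun_eq_iff)

lift_definition gbasis :: "nat set \<Rightarrow> 'k::comm_ring_1 grassmann"
  is "\<lambda>A B. if finite A \<and> B = A then 1 else 0"
  by auto

definition gen :: "nat \<Rightarrow> 'k::comm_ring_1 grassmann" where
  "gen i = gbasis {i}"

lemma gcoeff_gen: "gcoeff (gen i) B = (if B = {i} then 1 else 0)"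
  unfolding gen_def by transfer simp

lemma gcoeff_0 [simp]: "gcoeff 0 A = 0" by transfer simp
lemma gcoeff_add [simp]: "gcoeff (f + g) A = gcoeff f A + gcoeff g A" by transfer simp
lemma gcoeff_uminus [simp]: "gcoeff (- f) A = - gcoeff f A" by transfer simp
lemma gcoeff_scale [simp]: "gcoeff (c *\<^sub>G f) A = c * gcoeff f A" by transfer simp
lemma gcoeff_sum [simp]: "gcoeff (\<Sum>i\<in>I. f i) A = (\<Sum>i\<in>I. gcoeff (f i) A)"
  by (induction I rule: infinite_finite_induct) auto
lemma gcoeff_mult: "gcoeff (f * g) C = (\<Sum>A\<in>Pow C. gsign A (C - A) * gcoeff f A * gcoeff g (C - A))"
  by transfer simp
lemma gcoeff_basis: "gcoeff (gbasis A) B = (if finite A \<and> B = A then 1 else 0)"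
  by transfer simp
lemma gcoeff_support: "finite {A. gcoeff f A \<noteq> 0}" "gcoeff f A \<noteq> 0 \<Longrightarrow> finite A"
  by (transfer, simp)+
lemma gcoeff_infinite: "infinite A \<Longrightarrow> gcoeff f A = 0"
  using gcoeff_support(2) by blast
lemma grassmann_eqI: "(\<And>A. finite A \<Longrightarrow> gcoeff f A = gcoeff g A) \<Longrightarrow> f = g"
  by (metis gcoeff_infinite gcoeff_inject ext)

lemma gbasis_expand: "f = (\<Sum>A | gcoeff f A \<noteq> 0. gcoeff f A *\<^sub>G gbasis A)"
proof (rule grassmann_eqI)
  fix B :: "nat set" assume B: "finite B"
  have "gcoeff (\<Sum>A | gcoeff f A \<noteq> 0. gcoeff f A *\<^sub>G gbasis A) B
      = (\<Sum>A | gcoeff f A \<noteq> 0. if A = B then gcoeff f B else 0)"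
    using B by (auto simp: gcoeff_basis intro!: sum.cong)
  thus "gcoeff f B = gcoeff (\<Sum>A | gcoeff f A \<noteq> 0. gcoeff f A *\<^sub>G gbasis A) B"
    using gcoeff_support(1)[of f] by simp
qed

lemma gbasis_empty: "gbasis {} = 1"
  by transfer auto

lemma gbasis_mult:
  assumes "finite A" "finite B"
  shows "gbasis A * gbasis B =
    (if A \<inter> B = {} then gsign A B *\<^sub>G gbasis (A \<union> B) else (0 :: 'k::comm_ring_1 grassmann))"
proof (rule grassmann_eqI)
  fix C :: "nat set" assume C: "finite C"
  have "gcoeff (gbasis A * gbasis B) C =
      (\<Sum>A'\<in>Pow C. if A' = A then gsign A (C - A) * gcoeff (gbasis B) (C - A) else (0::'k))"
    unfolding gcoeff_mult using assms by (intro sum.cong) (auto simp: gcoeff_basis)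
  also have "\<dots> = (if A \<subseteq> C \<and> C - A = B then gsign A B else 0)"
    using assms C by (auto simp: gcoeff_basis)
  also have "(A \<subseteq> C \<and> C - A = B) \<longleftrightarrow> (A \<inter> B = {} \<and> C = A \<union> B)" by auto
  finally show "gcoeff (gbasis A * gbasis B) C =
      gcoeff (if A \<inter> B = {} then gsign A B *\<^sub>G gbasis (A \<union> B) else (0 :: 'k grassmann)) C"
    using assms by (auto simp: gcoeff_basis)
qed

lemma gen_square: "gen i * gen i = 0"
  by (simp add: gen_def gbasis_mult)

lemma gen_anticommute: "gen i * gen j = - (gen j * gen i)"
proof (cases "i = j")
  case False
  have "gsign {i} {j} = (- gsign {j} {i} :: 'a)" using False by (auto simp: gsign_def)
  with False show ?thesis
    by (intro grassmann_eqI) (auto simp: gen_def gbasis_mult gcoeff_basis)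
qed (simp add: gen_square)

lemma gen_gbasis: "finite A \<Longrightarrow> i \<notin> A \<Longrightarrow> gen i * gbasis A = gsign {i} A *\<^sub>G gbasis (insert i A)"
  by (simp add: gen_def gbasis_mult)


section \<open>Partial superderivatives and pivot elements\<close>

definition homogeneous :: "nat \<Rightarrow> 'k::comm_ring_1 grassmann \<Rightarrow> bool" where
  "homogeneous d f \<longleftrightarrow> (\<forall>A. gcoeff f A \<noteq> 0 \<longrightarrow> (even (card A) \<longleftrightarrow> even d))"

definition odd_superderivation :: "('k::field grassmann \<Rightarrow> 'k grassmann) \<Rightarrow> bool" where
  "odd_superderivation D \<longleftrightarrow>
     Vector_Spaces.linear gscale gscale D \<and>
     (\<forall>d a. homogeneous d a \<longrightarrow> homogeneous (Suc d) (D a)) \<and>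
     (\<forall>d a b. homogeneous d a \<longrightarrow> D (a * b) = D a * b + (- 1) ^ d * (a * D b))"

definition gderiv :: "nat \<Rightarrow> 'k::field grassmann \<Rightarrow> 'k grassmann" where
  "gderiv i = (THE D. odd_superderivation D \<and> (\<forall>j. D (gen j) = (if j = i then 1 else 0)))"

text \<open>
  We show that this superderivation exists and is unique; explicitly, it sends
  \<open>x\<^sub>i x\<^sub>C = gsign {i} C \<cdot> x\<^bsub>C \<union> {i}\<^esub>\<close> to \<open>x\<^sub>C\<close> and \<open>x\<^sub>C\<close> to \<open>0\<close>, for \<open>i \<notin> C\<close>.
\<close>

lift_definition contraction :: "nat \<Rightarrow> 'k::comm_ring_1 grassmann \<Rightarrow> 'k grassmann"
  is "\<lambda>i f C. if i \<in> C then 0 else gsign {i} C * f (insert i C)"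
proof -
  fix i and f :: "nat set \<Rightarrow> 'k"
  assume f: "finite {A. f A \<noteq> 0} \<and> (\<forall>A. f A \<noteq> 0 \<longrightarrow> finite A)"
  let ?h = "\<lambda>C. if i \<in> C then 0 else gsign {i} C * f (insert i C)"
  have nz: "i \<notin> C \<and> f (insert i C) \<noteq> 0" if "?h C \<noteq> 0" for C
    using that by (metis mult_zero_right)
  have "{C. ?h C \<noteq> 0} \<subseteq> (\<lambda>A. A - {i}) ` {A. f A \<noteq> 0}"
  proof
    fix C assume "C \<in> {C. ?h C \<noteq> 0}"
    with nz have "i \<notin> C \<and> f (insert i C) \<noteq> 0" by blast
    thus "C \<in> (\<lambda>A. A - {i}) ` {A. f A \<noteq> 0}"
      by (intro image_eqI[of _ _ "insert i C"]) simp_all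
  qed
  moreover have "finite ((\<lambda>A. A - {i}) ` {A. f A \<noteq> 0})"
    using conjunct1[OF f] by (rule finite_imageI)
  ultimately have "finite {C. ?h C \<noteq> 0}" by (rule finite_subset)
  moreover have "\<forall>C. ?h C \<noteq> 0 \<longrightarrow> finite C"
    using nz conjunct2[OF f] by (metis finite_insert)
  ultimately show "finite {C. ?h C \<noteq> 0} \<and> (\<forall>C. ?h C \<noteq> 0 \<longrightarrow> finite C)" by (rule conjI)
qed

lemma gcoeff_contraction:
  "gcoeff (contraction i f) C = (if i \<in> C then 0 else gsign {i} C * gcoeff f (insert i C))"
  by transfer simp

lemma gcoeff_signed [simp]: "gcoeff ((- 1) ^ d * f) C = (- 1) ^ d * gcoeff f C"
  by (cases "even d") simp_all

lemma sum_Pow_insert: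
  assumes "finite C" "i \<notin> C"
  shows "sum h (Pow (insert i C)) = (\<Sum>A\<in>Pow C. h A + h (insert i A))"
proof -
  have "inj_on (insert i) (Pow C)" "Pow C \<inter> insert i ` Pow C = {}"
    using assms by (auto simp: inj_on_def)
  thus ?thesis
    using assms by (simp add: Pow_insert sum.union_disjoint sum.reindex sum.distrib)
qed

lemma contraction_mult:
  assumes "homogeneous d f"
  shows "contraction i (f * g) = contraction i f * g + (- 1) ^ d * (f * contraction i g)"
proof (rule grassmann_eqI)
  fix C :: "nat set" assume C: "finite C"
  have card: "(- 1) ^ card A * gcoeff f A = (- 1) ^ d * gcoeff f A" for A
    using assms by (cases "gcoeff f A = 0") (auto simp: homogeneous_def minus_one_power_iff)
  have rhs: "gcoeff (contraction i f * g + (- 1) ^ d * (f * contraction i g)) C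
      = (\<Sum>A\<in>Pow C. gsign A (C - A) * gcoeff (contraction i f) A * gcoeff g (C - A)
          + (- 1) ^ d * (gsign A (C - A) * gcoeff f A * gcoeff (contraction i g) (C - A)))"
    by (simp only: gcoeff_add gcoeff_signed sum.distrib sum_distrib_left[symmetric])
       (simp only: gcoeff_mult)
  show "gcoeff (contraction i (f * g)) C =
      gcoeff (contraction i f * g + (- 1) ^ d * (f * contraction i g)) C"
  proof (cases "i \<in> C")
    case False
    have "gsign {i} C * (gsign A (insert i C - A) * gcoeff f A * gcoeff g (insert i C - A)
          + gsign (insert i A) (insert i C - insert i A) * gcoeff f (insert i A)
              * gcoeff g (insert i C - insert i A))
        = gsign A (C - A) * gcoeff (contraction i f) A * gcoeff g (C - A)
          + (- 1) ^ d * (gsign A (C - A) * gcoeff f A * gcoeff (contraction i g) (C - A))"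
      if A: "A \<in> Pow C" for A
    proof -
      let ?B = "C - A"
      have fin: "finite A" "finite ?B" and i: "i \<notin> A" "i \<notin> ?B"
        using A C False finite_subset by auto
      have eqs: "insert i C - A = insert i ?B" "insert i C - insert i A = ?B" using i False by auto
      have s1: "gsign {i} C = (gsign {i} A * gsign {i} ?B :: 'a)"
        using gsign_Un_right[of A ?B "{i}"] fin A by (simp add: Un_absorb1)
      have s2: "gsign {i} C * gsign (insert i A) ?B = (gsign A ?B * gsign {i} A :: 'a)"
        using fin i by (simp add: s1 gsign_insert_left[of A i] mult_ac)
      have "gsign {i} C * gsign A (insert i ?B)
          = (gsign {i} A * gsign A {i}) * gsign A ?B * (gsign {i} ?B :: 'a)"
        using fin i by (simp add: s1 gsign_insert_right[of ?B i] mult_ac)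
      hence s3: "gsign {i} C * gsign A (insert i ?B) = (- 1) ^ card A * gsign A ?B * (gsign {i} ?B :: 'a)"
        using fin i by (simp add: gsign_swap)
      have "gsign {i} C * (gsign A (insert i ?B) * gcoeff f A * gcoeff g (insert i ?B))
          = (gsign {i} C * gsign A (insert i ?B)) * gcoeff f A * gcoeff g (insert i ?B)"
        by (simp only: mult_ac)
      also have "\<dots> = ((- 1) ^ card A * gcoeff f A) * gsign A ?B * gsign {i} ?B * gcoeff g (insert i ?B)"
        unfolding s3 by (simp only: mult_ac)
      also have "\<dots> = (- 1) ^ d * (gsign A ?B * gcoeff f A * gcoeff (contraction i g) ?B)"
        unfolding card using i by (simp add: gcoeff_contraction mult_ac)
      finally have t1: "gsign {i} C * (gsign A (insert i ?B) * gcoeff f A * gcoeff g (insert i ?B))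
          = (- 1) ^ d * (gsign A ?B * gcoeff f A * gcoeff (contraction i g) ?B)" .
      have "gsign {i} C * (gsign (insert i A) ?B * gcoeff f (insert i A) * gcoeff g ?B)
          = (gsign {i} C * gsign (insert i A) ?B) * gcoeff f (insert i A) * gcoeff g ?B"
        by (simp only: mult_ac)
      also have "\<dots> = gsign A ?B * gcoeff (contraction i f) A * gcoeff g ?B"
        unfolding s2 using i by (simp add: gcoeff_contraction mult_ac)
      finally show ?thesis unfolding eqs using t1 by (simp only: distrib_left add.commute)
    qed
    hence "gsign {i} C * (\<Sum>A\<in>Pow C. gsign A (insert i C - A) * gcoeff f A * gcoeff g (insert i C - A)
          + gsign (insert i A) (insert i C - insert i A) * gcoeff f (insert i A)
              * gcoeff g (insert i C - insert i A))
        = (\<Sum>A\<in>Pow C. gsign A (C - A) * gcoeff (contraction i f) A * gcoeff g (C - A)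
          + (- 1) ^ d * (gsign A (C - A) * gcoeff f A * gcoeff (contraction i g) (C - A)))"
      unfolding sum_distrib_left by (intro sum.cong refl)
    moreover have "gcoeff (contraction i (f * g)) C = gsign {i} C * gcoeff (f * g) (insert i C)"
      using False by (simp add: gcoeff_contraction)
    ultimately show ?thesis
      unfolding rhs by (simp only: gcoeff_mult sum_Pow_insert[OF C False])
  next
    case True
    define C' where "C' = C - {i}"
    have C': "C = insert i C'" "i \<notin> C'" "finite C'" using True C by (auto simp: C'_def)
    have "gsign A (C - A) * gcoeff (contraction i f) A * gcoeff g (C - A)
          + gsign (insert i A) (C - insert i A) * gcoeff (contraction i f) (insert i A) * gcoeff g (C - insert i A)
          + (- 1) ^ d * (gsign A (C - A) * gcoeff f A * gcoeff (contraction i g) (C - A)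
          + gsign (insert i A) (C - insert i A) * gcoeff f (insert i A) * gcoeff (contraction i g) (C - insert i A)) = 0"
      if A: "A \<in> Pow C'" for A
    proof -
      let ?B = "C' - A"
      have fin: "finite A" "finite ?B" and i: "i \<notin> A" "i \<notin> ?B"
        using A C' finite_subset by auto
      have eqs: "C - A = insert i ?B" "C - insert i A = ?B" using i C' by auto
      have s: "gsign A (insert i ?B) * gsign {i} A = (- 1) ^ card A * (gsign A ?B :: 'a)"
      proof -
        have "gsign A (insert i ?B) * gsign {i} A = (gsign {i} A * gsign A {i}) * (gsign A ?B :: 'a)"
          using fin i by (simp add: gsign_insert_right[of ?B i] mult_ac)
        thus ?thesis using fin i by (simp add: gsign_swap)
      qed
      have s': "gsign (insert i A) ?B * gsign {i} ?B = (gsign A ?B :: 'a)"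
        using fin i by (simp add: gsign_insert_left[of A i] mult_ac)
      have c: "(- 1) ^ d * gcoeff f (insert i A) = - ((- 1) ^ card A * gcoeff f (insert i A))"
        using card[of "insert i A"] fin i by simp
      have "gsign A (insert i ?B) * gcoeff (contraction i f) A * gcoeff g (insert i ?B)
          = (gsign A (insert i ?B) * gsign {i} A) * gcoeff f (insert i A) * gcoeff g (insert i ?B)"
        using i by (simp add: gcoeff_contraction mult_ac)
      also have "\<dots> = gsign A ?B * ((- 1) ^ card A * gcoeff f (insert i A)) * gcoeff g (insert i ?B)"
        unfolding s by (simp only: mult_ac)
      finally have t1: "gsign A (insert i ?B) * gcoeff (contraction i f) A * gcoeff g (insert i ?B)
          = gsign A ?B * ((- 1) ^ card A * gcoeff f (insert i A)) * gcoeff g (insert i ?B)" .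
      have "(- 1) ^ d * (gsign (insert i A) ?B * gcoeff f (insert i A) * gcoeff (contraction i g) ?B)
          = (gsign (insert i A) ?B * gsign {i} ?B) * ((- 1) ^ d * gcoeff f (insert i A)) * gcoeff g (insert i ?B)"
        using i by (simp add: gcoeff_contraction mult_ac)
      also have "\<dots> = - (gsign A ?B * ((- 1) ^ card A * gcoeff f (insert i A)) * gcoeff g (insert i ?B))"
        unfolding s' c by simp
      finally show ?thesis unfolding eqs using t1 by (simp add: gcoeff_contraction)
    qed
    hence "(\<Sum>A\<in>Pow C'. gsign A (C - A) * gcoeff (contraction i f) A * gcoeff g (C - A)
          + gsign (insert i A) (C - insert i A) * gcoeff (contraction i f) (insert i A) * gcoeff g (C - insert i A)
          + (- 1) ^ d * (gsign A (C - A) * gcoeff f A * gcoeff (contraction i g) (C - A)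
          + gsign (insert i A) (C - insert i A) * gcoeff f (insert i A) * gcoeff (contraction i g) (C - insert i A))) = 0"
      by (intro sum.neutral ballI)
    moreover have "gcoeff (contraction i (f * g)) C = 0"
      using True by (simp add: gcoeff_contraction)
    moreover have "Pow C = Pow (insert i C')" using C' by simp
    ultimately show ?thesis
      unfolding rhs using C'(2,3) by (simp add: sum_Pow_insert distrib_left add_ac)
  qed
qed

lemma contraction_linear: "Vector_Spaces.linear gscale gscale (contraction i :: 'k::field grassmann \<Rightarrow> _)"
  unfolding Vector_Spaces.linear_iff
  by (auto intro!: grassmann_eqI grassmann.vector_space_axioms simp: gcoeff_contraction algebra_simps)

lemma contraction_gen: "contraction i (gen j) = (if j = i then 1 else 0)"
proof (rule grassmann_eqI)
  fix C :: "nat set"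
  have "insert i C = {j} \<longleftrightarrow> j = i \<and> C = {}" if "i \<notin> C" using that by auto
  thus "gcoeff (contraction i (gen j)) C = gcoeff (if j = i then 1 else 0) C"
    by (auto simp: gcoeff_contraction gcoeff_gen gcoeff_basis simp flip: gbasis_empty)
qed

lemma odd_superderivation_contraction: "odd_superderivation (contraction i)"
  unfolding odd_superderivation_def
proof (intro conjI allI impI)
  fix d :: nat and a :: "'a grassmann" assume a: "homogeneous d a"
  show "homogeneous (Suc d) (contraction i a)"
    unfolding homogeneous_def
  proof (intro allI impI)
    fix A assume nz: "gcoeff (contraction i a) A \<noteq> 0"
    hence "i \<notin> A" "gcoeff a (insert i A) \<noteq> 0" "finite A"
      using gcoeff_support(2)[OF nz] by (auto simp: gcoeff_contraction split: if_splits)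
    with a have "even (card (insert i A)) \<longleftrightarrow> even d" by (auto simp: homogeneous_def)
    with \<open>i \<notin> A\<close> \<open>finite A\<close> show "even (card A) \<longleftrightarrow> even (Suc d)" by auto
  qed
qed (auto intro: contraction_linear contraction_mult)

lemma homogeneous_gen: "homogeneous 1 (gen i)"
  by (simp add: homogeneous_def gcoeff_gen)

lemma odd_superderivation_unique:
  fixes D E :: "'k::field grassmann \<Rightarrow> 'k grassmann"
  assumes D: "odd_superderivation D" and E: "odd_superderivation E"
    and eq: "\<And>j. D (gen j) = E (gen j)"
  shows "D = E"
proof
  have lin: "Vector_Spaces.linear gscale gscale D" "Vector_Spaces.linear gscale gscale E"
    using D E by (auto simp: odd_superderivation_def)
  interpret D: Vector_Spaces.linear gscale gscale D by (rule lin(1))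
  interpret E: Vector_Spaces.linear gscale gscale E by (rule lin(2))
  have one: "X 1 = 0" if "odd_superderivation X" for X :: "'k grassmann \<Rightarrow> 'k grassmann"
  proof -
    have "homogeneous 0 (1 :: 'k grassmann)"
      unfolding gbasis_empty[symmetric] by (simp add: homogeneous_def gcoeff_basis)
    hence "X (1 * 1) = X 1 * 1 + (- 1) ^ 0 * (1 * X 1)"
      using that unfolding odd_superderivation_def by blast
    thus ?thesis by simp
  qed
  have gen_step: "X (gen j * b) = X (gen j) * b + (- 1) ^ 1 * (gen j * X b)"
    if "odd_superderivation X" for X j and b :: "'k grassmann"
    using that homogeneous_gen unfolding odd_superderivation_def by blast
  have basis: "D (gbasis A) = E (gbasis A)" if "finite A" for A
    using that
  proof induction
    case empty
    show ?case by (simp add: gbasis_empty one D E)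
  next
    case (insert j A)
    have "D (gen j * gbasis A) = E (gen j * gbasis A)"
      by (simp only: gen_step[OF D] gen_step[OF E] eq insert.IH)
    hence "gsign {j} A *\<^sub>G D (gbasis (insert j A)) = gsign {j} A *\<^sub>G E (gbasis (insert j A))"
      using insert.hyps by (simp add: gen_gbasis D.scale E.scale)
    hence "gsign {j} A *\<^sub>G gsign {j} A *\<^sub>G D (gbasis (insert j A))
        = gsign {j} A *\<^sub>G gsign {j} A *\<^sub>G E (gbasis (insert j A))" by (rule arg_cong)
    thus ?case by (simp only: grassmann.scale_scale gsign_square grassmann.scale_one)
  qed
  fix f
  have "D (\<Sum>A | gcoeff f A \<noteq> 0. gcoeff f A *\<^sub>G gbasis A) = E (\<Sum>A | gcoeff f A \<noteq> 0. gcoeff f A *\<^sub>G gbasis A)"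
    unfolding D.sum E.sum D.scale E.scale
  proof (intro sum.cong refl)
    fix A assume "A \<in> {A. gcoeff f A \<noteq> 0}"
    hence "finite A" using gcoeff_support(2) by blast
    thus "gcoeff f A *\<^sub>G D (gbasis A) = gcoeff f A *\<^sub>G E (gbasis A)" by (simp only: basis)
  qed
  thus "D f = E f" by (simp flip: gbasis_expand)
qed

lemma gderiv_eq_contraction: "gderiv i = contraction i"
  unfolding gderiv_def
  by (rule the_equality)
     (auto simp: contraction_gen odd_superderivation_contraction
           intro!: odd_superderivation_unique[OF _ odd_superderivation_contraction])

lemma odd_superderivation_gderiv: "odd_superderivation (gderiv i)"
  by (simp add: gderiv_eq_contraction odd_superderivation_contraction)

lemma gderiv_gen: "gderiv i (gen j) = (if j = i then 1 else 0)"
  by (simp add: gderiv_eq_contraction contraction_gen)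

lemma gcoeff_gderiv:
  "gcoeff (gderiv i f) C = (if i \<in> C then 0 else gsign {i} C * gcoeff f (insert i C))"
  by (simp add: gderiv_eq_contraction gcoeff_contraction)

text \<open>
  \<open>v\<^sub>i = \<Sum>\<^sub>k x\<^sub>i x\<^bsub>i+1\<^esub> \<cdots> x\<^bsub>i+2k-1\<^esub> \<partial>\<^bsub>i+2k\<^esub>\<close>; on each element only finitely many summands are nonzero.
\<close>

definition pivot :: "nat \<Rightarrow> 'k::field grassmann \<Rightarrow> 'k grassmann" where
  "pivot i f = Sum_any (\<lambda>k. prod_list (map gen [i..<i + 2 * k]) * gderiv (i + 2 * k) f)"

lemma finite_gderiv_nonzero: "finite {j. gderiv j f \<noteq> 0}"
proof -
  have "{j. gderiv j f \<noteq> 0} \<subseteq> \<Union> {A. gcoeff f A \<noteq> 0}"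
  proof
    fix j assume "j \<in> {j. gderiv j f \<noteq> 0}"
    then obtain C where "gcoeff (gderiv j f) C \<noteq> 0"
      using grassmann_eqI[of "gderiv j f" 0] by auto
    hence "gcoeff f (insert j C) \<noteq> 0" by (auto simp: gcoeff_gderiv split: if_splits)
    thus "j \<in> \<Union> {A. gcoeff f A \<noteq> 0}" by blast
  qed
  moreover have "finite (\<Union> {A. gcoeff f A \<noteq> 0})"
    using gcoeff_support[of f] by (intro finite_Union) auto
  ultimately show ?thesis by (rule finite_subset)
qed

lemma finite_pivot_support:
  "finite {k. prod_list (map gen [i..<i + 2 * k]) * gderiv (i + 2 * k) f \<noteq> 0}"
proof -
  have "{k. prod_list (map gen [i..<i + 2 * k]) * gderiv (i + 2 * k) f \<noteq> 0}
      \<subseteq> (\<lambda>k. i + 2 * k) -` {j. gderiv j f \<noteq> 0}"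
    by (auto simp del: mult_eq_0_iff)
  moreover have "finite ((\<lambda>k. i + 2 * k) -` {j. gderiv j f \<noteq> 0})"
    by (intro finite_vimageI finite_gderiv_nonzero) (simp add: inj_def)
  ultimately show ?thesis by (rule finite_subset)
qed

lemma pivot_rec: "pivot i f = gderiv i f + gen i * gen (i + 1) * pivot (i + 2) f"
proof -
  let ?t = "\<lambda>i k. prod_list (map gen [i..<i + 2 * k]) * gderiv (i + 2 * k) f"
  obtain N where N: "\<And>k. ?t i k \<noteq> 0 \<Longrightarrow> k < N" "\<And>k. ?t (i + 2) k \<noteq> 0 \<Longrightarrow> k < N"
  proof -
    have "finite ({k. ?t i k \<noteq> 0} \<union> {k. ?t (i + 2) k \<noteq> 0})"
      by (intro finite_UnI finite_pivot_support)
    then obtain N where "\<forall>k \<in> {k. ?t i k \<noteq> 0} \<union> {k. ?t (i + 2) k \<noteq> 0}. k < N"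
      using finite_nat_set_iff_bounded by blast
    thus ?thesis by (intro that[of N]) auto
  qed
  have step: "?t i (Suc k) = gen i * gen (i + 1) * ?t (i + 2) k" for k
  proof -
    have "[i..<i + 2 * Suc k] = i # (i + 1) # [i + 2..<i + 2 + 2 * k]"
      using upt_conv_Cons[of i "i + 2 * Suc k"] upt_conv_Cons[of "i + 1" "i + 2 * Suc k"] by simp
    moreover have "i + 2 * Suc k = i + 2 + 2 * k" by simp
    ultimately show ?thesis by (simp only: list.map prod_list.Cons mult.assoc)
  qed
  have sub: "{k. ?t i k \<noteq> 0} \<subseteq> {..<Suc N}" "{k. ?t (i + 2) k \<noteq> 0} \<subseteq> {..<N}"
    using N less_SucI by blast+
  have "pivot i f = sum (?t i) {..<Suc N}"
    unfolding pivot_def using sub(1) by (intro Sum_any.expand_superset) simp_all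
  also have "\<dots> = ?t i 0 + (\<Sum>k<N. ?t i (Suc k))" by (rule sum.lessThan_Suc_shift)
  also have "(\<Sum>k<N. ?t i (Suc k)) = gen i * gen (i + 1) * sum (?t (i + 2)) {..<N}"
    by (simp only: step sum_distrib_left)
  also have "sum (?t (i + 2)) {..<N} = pivot (i + 2) f"
    unfolding pivot_def using sub(2) by (intro Sum_any.expand_superset[symmetric]) simp_all
  finally show ?thesis by simp
qed

lemma pivot_linear: "Vector_Spaces.linear gscale gscale (pivot i :: 'k::field grassmann \<Rightarrow> _)"
proof -
  have lin: "Vector_Spaces.linear gscale gscale (gderiv j :: 'k grassmann \<Rightarrow> _)" for j
    using odd_superderivation_gderiv[of j] by (auto simp: odd_superderivation_def)
  have "pivot i (f + g) = pivot i f + pivot i g" for f g :: "'k grassmann"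
    unfolding pivot_def Vector_Spaces.linear_iff[THEN iffD1, OF lin, THEN conjunct2, THEN conjunct2, THEN conjunct1, rule_format]
      distrib_left
    by (rule Sum_any.distrib) (rule finite_pivot_support)+
  moreover have "pivot i (c *\<^sub>G f) = c *\<^sub>G pivot i f" for c and f :: "'k grassmann"
  proof -
    let ?t = "\<lambda>k. prod_list (map gen [i..<i + 2 * k]) * gderiv (i + 2 * k) f"
    have scale: "c *\<^sub>G a = (c *\<^sub>G 1) * a" for a :: "'k grassmann"
      by (simp add: gscale_mult_left)
    have fin: "finite {k. ?t k \<noteq> 0}" by (rule finite_pivot_support)
    have "pivot i (c *\<^sub>G f) = Sum_any (\<lambda>k. c *\<^sub>G ?t k)"
      unfolding pivot_def
        Vector_Spaces.linear_iff[THEN iffD1, OF lin, THEN conjunct2, THEN conjunct2, THEN conjunct2, rule_format]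
        gscale_mult_right ..
    also have "\<dots> = sum (\<lambda>k. c *\<^sub>G ?t k) {k. ?t k \<noteq> 0}"
      using fin by (intro Sum_any.expand_superset) auto
    also have "\<dots> = c *\<^sub>G sum ?t {k. ?t k \<noteq> 0}"
      by (rule grassmann.scale_sum_right[symmetric])
    also have "sum ?t {k. ?t k \<noteq> 0} = pivot i f"
      unfolding pivot_def by (rule Sum_any.expand_set[symmetric])
    finally show ?thesis .
  qed
  ultimately show ?thesis
    unfolding Vector_Spaces.linear_iff using grassmann.vector_space_axioms by blast
qed

section \<open>Growth\<close>

definition escale :: "'k::comm_ring_1 \<Rightarrow> ('k grassmann \<Rightarrow> 'k grassmann) \<Rightarrow> 'k grassmann \<Rightarrow> 'k grassmann" where
  "escale c F = (\<lambda>f. c *\<^sub>G F f)"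

interpretation endo: vector_space "escale :: 'k::field \<Rightarrow> _"
  by unfold_locales (simp_all add: escale_def fun_eq_iff grassmann.scale_right_distrib grassmann.scale_left_distrib)

definition monomial :: "('i \<Rightarrow> 'a \<Rightarrow> 'a) \<Rightarrow> 'i list \<Rightarrow> 'a \<Rightarrow> 'a" where
  "monomial v w = foldr (\<lambda>i F. v i \<circ> F) w id"

inductive_set assoc_alg :: "('k::field grassmann \<Rightarrow> 'k grassmann) set \<Rightarrow> ('k grassmann \<Rightarrow> 'k grassmann) set"
  for X where
    assoc_alg_base: "F \<in> X \<Longrightarrow> F \<in> assoc_alg X"
  | assoc_alg_zero: "0 \<in> assoc_alg X"
  | assoc_alg_add: "F \<in> assoc_alg X \<Longrightarrow> G \<in> assoc_alg X \<Longrightarrow> F + G \<in> assoc_alg X"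
  | assoc_alg_scale: "F \<in> assoc_alg X \<Longrightarrow> escale c F \<in> assoc_alg X"
  | assoc_alg_comp: "F \<in> assoc_alg X \<Longrightarrow> G \<in> assoc_alg X \<Longrightarrow> F \<circ> G \<in> assoc_alg X"

lemma monomial_Nil [simp]: "monomial v [] = id"
  and monomial_Cons [simp]: "monomial v (i # w) = v i \<circ> monomial v w"
  by (simp_all add: monomial_def)

lemma monomial_append: "monomial v (w @ w') = monomial v w \<circ> monomial v w'"
  by (induction w) (simp_all add: comp_assoc)

text \<open>
  The algebra generated by the \<open>v i\<close> is the span of the monomials, so the functions below
  measure its growth with respect to these generators.
\<close>

lemma assoc_alg_eq_span_monomials:
  fixes v :: "'i \<Rightarrow> 'k::field grassmann \<Rightarrow> 'k grassmann"
  assumes lin: "\<And>i. i \<in> I \<Longrightarrow> Vector_Spaces.linear gscale gscale (v i)"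
  shows "assoc_alg (v ` I) = endo.span {monomial v w | w. w \<in> lists I \<and> w \<noteq> []}" (is "_ = endo.span ?M")
proof (intro subset_antisym subsetI)
  have linmon: "Vector_Spaces.linear gscale gscale (monomial v w)" if "w \<in> lists I" for w
    using that
  proof (induction w)
    case Nil
    show ?case by (simp add: id_def grassmann.linear_ident)
  next
    case (Cons i w)
    hence "Vector_Spaces.linear gscale gscale (v i \<circ> monomial v w)"
      by (intro Vector_Spaces.linear_compose[OF _ lin]) auto
    thus ?case by (simp only: monomial_Cons)
  qed
  have left: "monomial v w \<circ> G \<in> endo.span ?M" if "G \<in> endo.span ?M" "w \<in> lists I" for w G
  proof -
    interpret L: Vector_Spaces.linear gscale gscale "monomial v w" by (rule linmon) fact
    show ?thesis
      using that(1)
    proof (induction rule: endo.span_induct_alt)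
      case base
      have "monomial v w \<circ> 0 = (0 :: 'k grassmann \<Rightarrow> 'k grassmann)" by (simp add: fun_eq_iff L.zero)
      thus ?case by (simp only: endo.span_zero)
    next
      case (step c F G)
      then obtain w' where w': "F = monomial v w'" "w' \<in> lists I" "w' \<noteq> []" by blast
      hence "w @ w' \<in> lists I" "w @ w' \<noteq> []" using that(2) by simp_all
      hence "monomial v (w @ w') \<in> ?M" by blast
      hence "escale c (monomial v (w @ w')) \<in> endo.span ?M" by (intro endo.span_scale endo.span_base)
      moreover have "monomial v w \<circ> (escale c F + G) = escale c (monomial v (w @ w')) + (monomial v w \<circ> G)"
        by (simp add: fun_eq_iff escale_def w' monomial_append L.add L.scale)
      ultimately show ?case using step.IH by (simp only: endo.span_add)
    qed
  qed
  fix F assume "F \<in> assoc_alg (v ` I)"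
  thus "F \<in> endo.span ?M"
  proof induction
    case (assoc_alg_base F)
    then obtain i where i: "i \<in> I" "F = v i" by blast
    hence "F = monomial v [i]" "[i] \<in> lists I" by simp_all
    hence "F \<in> ?M" by blast
    thus ?case by (rule endo.span_base)
  next
    case (assoc_alg_comp F G)
    from assoc_alg_comp.IH(1) show ?case
    proof (induction rule: endo.span_induct_alt)
      case base
      have "0 \<circ> G = (0 :: 'k grassmann \<Rightarrow> 'k grassmann)" by (simp add: fun_eq_iff)
      thus ?case by (simp only: endo.span_zero)
    next
      case (step c F F')
      then obtain w where w: "F = monomial v w" "w \<in> lists I" by blast
      hence "escale c (F \<circ> G) \<in> endo.span ?M"
        using left[OF assoc_alg_comp.IH(2)] by (simp only: endo.span_scale)
      moreover have "(escale c F + F') \<circ> G = escale c (F \<circ> G) + (F' \<circ> G)"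
        by (simp add: fun_eq_iff escale_def)
      ultimately show ?case using step.IH by (simp only: endo.span_add)
    qed
  qed (simp_all only: endo.span_zero endo.span_add endo.span_scale)
next
  fix F assume "F \<in> endo.span ?M"
  thus "F \<in> assoc_alg (v ` I)"
  proof (induction rule: endo.span_induct_alt)
    case (step c F G)
    then obtain w where w: "F = monomial v w" "w \<in> lists I" "w \<noteq> []" by blast
    from w(2,3) have "monomial v w \<in> assoc_alg (v ` I)"
    proof (induction w)
      case (Cons i w)
      hence "v i \<in> assoc_alg (v ` I)" by (auto intro: assoc_alg_base)
      moreover have "w = [] \<or> monomial v w \<in> assoc_alg (v ` I)" using Cons by auto
      ultimately show ?case
      proof (elim disjE)
        assume "monomial v w \<in> assoc_alg (v ` I)"
        with \<open>v i \<in> assoc_alg (v ` I)\<close> show ?thesis unfolding monomial_Cons by (rule assoc_alg_comp)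
      qed simp
    qed simp
    thus ?case unfolding w(1) by (intro assoc_alg_add assoc_alg_scale step.IH)
  qed (rule assoc_alg_zero)
qed

text \<open>
  The algebras are without unit, so the empty word is excluded.  In \<open>weight_growth\<close> the
  generators \<open>v i\<close>, \<open>i \<in> I\<close>, have weights \<open>wt i\<close>; \<open>growth\<close> is ordinary growth (by length).
\<close>

definition weight_growth ::
    "'i set \<Rightarrow> ('i \<Rightarrow> nat) \<Rightarrow> ('i \<Rightarrow> 'k::field grassmann \<Rightarrow> 'k grassmann) \<Rightarrow> nat \<Rightarrow> nat" where
  "weight_growth I wt v m =
     endo.dim (endo.span {monomial v w | w. w \<in> lists I \<and> w \<noteq> [] \<and> sum_list (map wt w) \<le> m})"

definition growth ::
    "'i set \<Rightarrow> ('i \<Rightarrow> 'k::field grassmann \<Rightarrow> 'k grassmann) \<Rightarrow> nat \<Rightarrow> nat" where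
  "growth I v m =
     endo.dim (endo.span {monomial v w | w. w \<in> lists I \<and> w \<noteq> [] \<and> length w \<le> m})"

definition GKdim :: "'i set \<Rightarrow> ('i \<Rightarrow> 'k::field grassmann \<Rightarrow> 'k grassmann) \<Rightarrow> ereal" where
  "GKdim I v = limsup (\<lambda>n. ereal (ln (real (growth I v n)) / ln (real n)))"

definition lower_GKdim :: "'i set \<Rightarrow> ('i \<Rightarrow> 'k::field grassmann \<Rightarrow> 'k grassmann) \<Rightarrow> ereal" where
  "lower_GKdim I v = liminf (\<lambda>n. ereal (ln (real (growth I v n)) / ln (real n)))"

definition pivot_weight :: "nat \<Rightarrow> nat" where
  "pivot_weight i = (if i = 0 then 1 else 2)"

end

theory Submission
  imports Defs
begin

text \<open>
  Upper bound: with \<open>2\<^sup>j \<ge> m\<close>, a monomial in \<open>v\<^sub>0, v\<^sub>1\<close> of weight at most \<open>m\<close> is a combination of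
  operators \<open>e\<^sub>0 \<cdots> e\<^bsub>j-1\<^esub> y\<close> with \<open>e\<^sub>i \<in> {1, x\<^sub>i, \<partial>\<^sub>i, x\<^sub>i \<partial>\<^sub>i}\<close> and \<open>y\<close> a word in \<open>x\<^sub>j, v\<^sub>j, v\<^bsub>j+1\<^esub>\<close>.
  All letters are homogeneous (\<open>wt(v\<^sub>i) = wt(\<partial>\<^sub>i) = 2\<^sup>i = - wt(x\<^sub>i)\<close>), so \<open>y\<close> has weight below
  \<open>m + 2\<^sup>j\<close>, hence bounded length, and there are at most \<open>30 \<cdot> 4\<^sup>j\<close> such operators.

  Lower bound: the relations \<open>v\<^bsub>i+2\<^esub> = [v\<^bsub>i+1\<^esub>, v\<^sub>i\<^sup>2]\<close> and \<open>v\<^sub>i v\<^bsub>i+1\<^esub> + v\<^bsub>i+1\<^esub> v\<^sub>i = - x\<^sub>i v\<^bsub>i+2\<^esub>\<close> place all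
  \<open>x\<^sub>A v\<^bsub>k+1\<^esub>\<close> with \<open>A \<subseteq> {0, \<dots>, k - 1}\<close> in \<open>\<^bold>A\<close>.  The \<open>4\<^sup>k\<close> products \<open>x\<^sub>A v\<^bsub>k+1\<^esub> v\<^sub>B\<close>, where \<open>v\<^sub>B\<close> is the
  ordered product of the \<open>v\<^sub>i\<close>, \<open>i \<in> B \<subseteq> {0, \<dots>, k - 1}\<close>, have weight at most \<open>2\<^bsup>k+2\<^esup>\<close> and are
  linearly independent: they behave like the operators \<open>x\<^sub>A \<partial>\<^sub>B\<close> up to terms with more letters \<open>x\<^sub>i\<close>.
\<close>

section \<open>Relations between pivot elements, letters and derivatives\<close>

interpretation gderiv: Vector_Spaces.linear gscale gscale "gderiv i :: 'k::field grassmann \<Rightarrow> 'k grassmann" for i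
  using odd_superderivation_gderiv unfolding odd_superderivation_def by blast

interpretation pivot: Vector_Spaces.linear gscale gscale "pivot i :: 'k::field grassmann \<Rightarrow> 'k grassmann" for i
  by (rule pivot_linear)

lemma gen_square_left [simp]: "gen i * (gen i * f) = 0"
  by (simp flip: mult.assoc add: gen_square)

lemma gen_left_commute: "gen i * (gen j * f) = - (gen j * (gen i * f))"
  by (simp only: mult.assoc[symmetric] gen_anticommute[of i j] mult_minus_left)

lemma gderiv_gen_mult:
  "gderiv i (gen j * f) = (if i = j then f else 0) - gen j * gderiv i (f :: 'k::field grassmann)"
proof -
  have "gderiv i (gen j * f) = gderiv i (gen j) * f + (- 1) ^ 1 * (gen j * gderiv i f)"
    using odd_superderivation_gderiv[of i] homogeneous_gen[of j]
    unfolding odd_superderivation_def by blast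
  thus ?thesis by (simp add: gderiv_gen)
qed

lemma gderiv_square [simp]: "gderiv i (gderiv i f) = 0"
  by (rule grassmann_eqI) (simp add: gcoeff_gderiv)

lemma gderiv_anticommute: "gderiv i (gderiv j f) = - gderiv j (gderiv i f)"
proof (rule grassmann_eqI)
  fix C :: "nat set" assume C: "finite C"
  show "gcoeff (gderiv i (gderiv j f)) C = gcoeff (- gderiv j (gderiv i f)) C"
  proof (cases "i = j \<or> i \<in> C \<or> j \<in> C")
    case False
    define a b c :: 'a where "a = gsign {i} C" and "b = gsign {j} C" and "c = gsign {i} {j}"
    have "gsign {j} {i} = - c" using False by (auto simp: gsign_def c_def)
    moreover have "gsign {i} (insert j C) = gsign {i} {j} * a" "gsign {j} (insert i C) = gsign {j} {i} * b"
      using False C unfolding a_def b_def by (blast intro: gsign_insert_right)+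
    ultimately have "gsign {i} (insert j C) = c * a" "gsign {j} (insert i C) = - c * b"
      by (simp_all add: c_def)
    with False show ?thesis
      by (simp add: gcoeff_gderiv insert_commute[of j i] a_def[symmetric] b_def[symmetric])
  qed (auto simp: gcoeff_gderiv)
qed

lemma gderiv_gbasis:
  "finite A \<Longrightarrow> gderiv i (gbasis A) =
     (if i \<in> A then gsign {i} (A - {i}) *\<^sub>G gbasis (A - {i}) else (0 :: 'k::field grassmann))"
  by (rule grassmann_eqI) (auto simp: gcoeff_gderiv gcoeff_basis)

text \<open>An element involves finitely many letters, and v_i contains only derivatives
  \<partial>_j with j \<ge> i.\<close>

lemma pivot_eventually_zero: "\<exists>N. \<forall>i\<ge>N. pivot i f = 0"
proof -
  obtain N where N: "\<forall>j\<in>{j. gderiv j f \<noteq> 0}. j < N"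
    using finite_gderiv_nonzero[of f] finite_nat_set_iff_bounded by blast
  have "pivot i f = 0" if "i \<ge> N" for i
  proof -
    have "gderiv (i + 2 * k) f = 0" for k using N that by (metis mem_Collect_eq not_le trans_le_add1)
    thus ?thesis by (simp add: pivot_def)
  qed
  thus ?thesis by blast
qed

text \<open>As \<open>v\<^sub>i\<close> is given by \<open>v\<^bsub>i+2\<^esub>\<close> and vanishes on a fixed element for large \<open>i\<close>, downward induction applies.\<close>

lemma pivot_induct [consumes 1, case_names zero step]:
  fixes F :: "'k::field grassmann set"
  assumes "finite F"
    and zero: "\<And>i. j < i \<Longrightarrow> (\<And>f. f \<in> F \<Longrightarrow> pivot i f = 0) \<Longrightarrow> P i"
    and step: "\<And>i. j < i \<Longrightarrow> P (i + 2) \<Longrightarrow> P i"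
    and "j < i"
  shows "P i"
proof -
  obtain N where N: "\<And>f :: 'k grassmann. \<forall>i\<ge>N f. pivot i f = 0" using pivot_eventually_zero by metis
  define M where "M = Max (insert 0 (N ` F))"
  have M: "N f \<le> M" if "f \<in> F" for f using that \<open>finite F\<close> unfolding M_def by simp
  have "j < i \<Longrightarrow> P i" for i
  proof (induction "M - i" arbitrary: i rule: less_induct)
    case less
    show ?case
    proof (cases "i < M")
      case True
      hence "M - (i + 2) < M - i" by simp
      thus ?thesis using less.prems by (intro step[OF _ less.hyps]) simp_all
    next
      case False
      hence "pivot i f = 0" if "f \<in> F" for f using M[OF that] N[of f] by simp
      thus ?thesis using less.prems zero by blast
    qed
  qed
  thus ?thesis using \<open>j < i\<close> .
qed

text \<open>Every summand of v_i is odd and involves only indices at least i. In the induction step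
  x_j passes the even factor x_i x_(i+1) without a sign.\<close>

lemma pivot_gen_mult:
  assumes "j < i"
  shows "pivot i (gen j * f) = - (gen j * pivot i f)"
proof (rule pivot_induct[of "{f, gen j * f}" j, OF _ _ _ assms])
  fix i assume i: "j < i" and IH: "pivot (i + 2) (gen j * f) = - (gen j * pivot (i + 2) f)"
  have "gen j * (gen i * (gen (i + 1) * g)) = gen i * (gen (i + 1) * (gen j * g))" for g :: "'a grassmann"
    by (simp add: gen_left_commute[of j])
  with i show "pivot i (gen j * f) = - (gen j * pivot i f)"
    by (simp add: pivot_rec[of i] gderiv_gen_mult IH[simplified] distrib_left mult.assoc)
qed simp_all

text \<open>The tail x_i x_(i+1) v_(i+2) of v_i is annihilated by x_i on either side, so the
  Clifford relation of \<partial>_i and x_i carries over to v_i.\<close>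

lemma pivot_gen_mult_self: "pivot i (gen i * f) = f - gen i * pivot i f"
proof -
  have "gen i * (gen (Suc i) * (gen i * g)) = 0" for g :: "'a grassmann"
    by (simp add: gen_left_commute[of i "Suc i"])
  thus ?thesis
    by (simp add: pivot_rec[of i] gderiv_gen_mult pivot_gen_mult distrib_left mult.assoc)
qed

lemma gderiv_pivot:
  assumes "j < i"
  shows "gderiv j (pivot i f) = - pivot i (gderiv j f)"
proof (rule pivot_induct[of "{f, gderiv j f}" j, OF _ _ _ assms])
  fix i assume i: "j < i" and IH: "gderiv j (pivot (i + 2) f) = - pivot (i + 2) (gderiv j f)"
  with i show "gderiv j (pivot i f) = - pivot i (gderiv j f)"
    by (simp add: pivot_rec[of i] gderiv_gen_mult gderiv.add gderiv.neg gderiv_anticommute[of j i] IH[simplified] mult.assoc)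
qed (simp_all add: gderiv.zero)

text \<open>With v_i = \<partial>_i + t, both \<partial>_i and t = x_i x_(i+1) v_(i+2) square to
  zero; only the anticommutator of \<partial>_i and t survives.\<close>

lemma pivot_square: "pivot i (pivot i f) = gen (i + 1) * pivot (i + 2) f"
proof -
  have "gen i * (gen (Suc i) * (gen i * g)) = 0" for g :: "'a grassmann"
    by (simp add: gen_left_commute[of i "Suc i"])
  thus ?thesis
    by (simp add: pivot_rec[of i] gderiv_gen_mult gderiv.add pivot.add pivot_gen_mult gderiv_pivot
        distrib_left mult.assoc)
qed

lemma gen_pivot_self: "gen i * pivot i f = gen i * gderiv i f"
  by (simp add: pivot_rec[of i] distrib_left mult.assoc)

lemma pivot_anticommutator:
  "pivot i (pivot (i + 1) f) + pivot (i + 1) (pivot i f) = - (gen i * pivot (i + 2) f)"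
proof -
  \<comment> \<open>Behind a factor x_(i+1), v_(i+1) acts as \<partial>_(i+1), which anticommutes
    with v_(i+2).\<close>
  have "gen (i + 1) * pivot (i + 2) (pivot (i + 1) f) = - pivot (i + 2) (gen (i + 1) * pivot (i + 1) f)"
    by (simp add: pivot_gen_mult)
  also have "\<dots> = - (gen (i + 1) * pivot (i + 1) (pivot (i + 2) f))"
    by (simp add: gen_pivot_self pivot_gen_mult gderiv_pivot)
  finally show ?thesis
    by (simp add: pivot_rec[of i] gderiv_pivot pivot.add pivot_gen_mult pivot_gen_mult_self
        distrib_left right_diff_distrib mult.assoc)
qed

text \<open>Since v_i^2 = x_(i+1) v_(i+2), its commutator with v_(i+1) is v_(i+2) minus x_(i+1)
  times the anticommutator of v_(i+1) and v_(i+2); that product vanishes because the anticommutator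
  begins with x_(i+1).\<close>

lemma pivot_add_2:
  "pivot (i + 2) f = pivot (i + 1) (pivot i (pivot i f)) - pivot i (pivot i (pivot (i + 1) f))"
proof -
  have "gen (i + 1) * (pivot (i + 1) (pivot (i + 2) f) + pivot (i + 2) (pivot (i + 1) f)) = 0"
    using pivot_anticommutator[of "i + 1" f] by (simp add: numeral_2_eq_2)
  thus ?thesis unfolding pivot_square pivot_gen_mult_self by (simp add: distrib_left add_eq_0_iff)
qed

lemma gbasis_insert_lt:
  assumes "finite S" "S \<subseteq> {..<k}"
  shows "gbasis (insert k S) = gbasis S * (gen k :: 'k::field grassmann)"
proof -
  have "gsign S {k} = (1 :: 'k)" using assms by (auto simp: gsign_def intro!: prod.neutral)
  moreover have "k \<notin> S" using assms by auto
  ultimately show ?thesis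
    using assms by (simp add: gen_def gbasis_mult)
qed

lemma pivot_gbasis_mult:
  assumes "finite S" "S \<subseteq> {..<i}"
  shows "pivot i (gbasis S * f) = (- 1) ^ card S * (gbasis S * pivot i f)"
  using assms
proof (induction S)
  case (insert j S)
  have "gbasis (insert j S) = gsign {j} S *\<^sub>G (gen j * gbasis S :: 'a grassmann)"
    using insert.hyps by (simp add: gen_gbasis)
  with insert show ?case
    by (cases "even (card S)") (simp_all add: gscale_mult_left pivot.scale pivot.neg pivot_gen_mult mult.assoc)
qed (simp add: gbasis_empty)

section \<open>The weight filtration\<close>

lemma linear_monomial:
  assumes "\<And>i. Vector_Spaces.linear gscale gscale (v i :: 'k::field grassmann \<Rightarrow> 'k grassmann)"
  shows "Vector_Spaces.linear gscale gscale (monomial v w)"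
proof (induction w)
  case (Cons i w)
  thus ?case unfolding monomial_Cons by (rule Vector_Spaces.linear_compose[OF _ assms])
qed (simp add: id_def grassmann.linear_ident)

text \<open>Composing with \<open>F\<close> on the left respects linear combinations because
  \<open>F\<close> is linear; in \<open>comp_in_span_right\<close> the combinations are taken
  pointwise.\<close>

lemma comp_in_span_left:
  fixes F G :: "'k::field grassmann \<Rightarrow> 'k grassmann"
  assumes F: "Vector_Spaces.linear gscale gscale F" and "G \<in> endo.span S"
    and base: "\<And>H. H \<in> S \<Longrightarrow> F \<circ> H \<in> endo.span T"
  shows "F \<circ> G \<in> endo.span T"
  using assms(2)
proof (induction rule: endo.span_induct_alt)
  interpret F: Vector_Spaces.linear gscale gscale F by (rule F)
  case base
  have "F \<circ> 0 = (0 :: 'k grassmann \<Rightarrow> 'k grassmann)" by (simp add: fun_eq_iff F.zero)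
  thus ?case by (simp only: endo.span_zero)
next
  interpret F: Vector_Spaces.linear gscale gscale F by (rule F)
  case (step c H G)
  have "F \<circ> (escale c H + G) = escale c (F \<circ> H) + (F \<circ> G)"
    by (simp add: fun_eq_iff escale_def F.add F.scale)
  thus ?case using step by (simp only: endo.span_add endo.span_scale base)
qed

lemma comp_in_span_right:
  fixes F G :: "'k::field grassmann \<Rightarrow> 'k grassmann"
  assumes "F \<in> endo.span S" and base: "\<And>H. H \<in> S \<Longrightarrow> H \<circ> G \<in> endo.span T"
  shows "F \<circ> G \<in> endo.span T"
  using assms(1)
proof (induction rule: endo.span_induct_alt)
  case base
  have "0 \<circ> G = (0 :: 'k grassmann \<Rightarrow> 'k grassmann)" by (simp add: fun_eq_iff)
  thus ?case by (simp only: endo.span_zero)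
next
  case (step c H F)
  have "(escale c H + F) \<circ> G = escale c (H \<circ> G) + (F \<circ> G)"
    by (simp add: fun_eq_iff escale_def)
  thus ?case using step by (simp only: endo.span_add endo.span_scale base)
qed

definition wspan :: "nat \<Rightarrow> ('k::field grassmann \<Rightarrow> 'k grassmann) set" where
  "wspan m = endo.span {monomial pivot w | w. w \<in> lists {0, 1} \<and> w \<noteq> [] \<and> sum_list (map pivot_weight w) \<le> m}"

lemma wspan_comp:
  assumes "F \<in> wspan a" "G \<in> wspan b"
  shows "F \<circ> G \<in> wspan (a + b)"
  using assms(1) unfolding wspan_def
proof (rule comp_in_span_right)
  let ?M = "\<lambda>m. {monomial pivot w :: 'a grassmann \<Rightarrow> _ | w. w \<in> lists {0, 1} \<and> w \<noteq> [] \<and> sum_list (map pivot_weight w) \<le> m}"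
  fix H assume "H \<in> ?M a"
  then obtain w where H: "H = monomial pivot w"
    and w: "w \<in> lists {0, 1}" "w \<noteq> []" "sum_list (map pivot_weight w) \<le> a" by blast
  show "H \<circ> G \<in> endo.span (?M (a + b))"
    unfolding H using assms(2) unfolding wspan_def
  proof (rule comp_in_span_left[OF linear_monomial[OF pivot_linear]])
    fix H' assume "H' \<in> ?M b"
    then obtain u where H': "H' = monomial pivot u"
      and u: "u \<in> lists {0, 1}" "u \<noteq> []" "sum_list (map pivot_weight u) \<le> b" by blast
    have "w @ u \<in> lists {0, 1} \<and> w @ u \<noteq> [] \<and> sum_list (map pivot_weight (w @ u)) \<le> a + b"
      using u w by auto
    thus "monomial pivot w \<circ> H' \<in> endo.span (?M (a + b))"
      unfolding H' monomial_append[symmetric] by (intro endo.span_base) blast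
  qed
qed

lemma wspan_mono: "a \<le> b \<Longrightarrow> wspan a \<subseteq> wspan b"
  unfolding wspan_def by (intro endo.span_mono) auto

lemma wspan_comp_le: "F \<in> wspan a \<Longrightarrow> G \<in> wspan b \<Longrightarrow> a + b \<le> c \<Longrightarrow> F \<circ> G \<in> wspan c"
  using wspan_comp wspan_mono by blast

lemma wspan_diff: "F \<in> wspan a \<Longrightarrow> G \<in> wspan a \<Longrightarrow> F - G \<in> wspan a"
  unfolding wspan_def by (rule endo.span_diff)

lemma wspan_uminus: "F \<in> wspan a \<Longrightarrow> - F \<in> wspan a"
  unfolding wspan_def by (rule endo.span_neg)

lemma wspan_signed:
  assumes "F \<in> wspan a"
  shows "(\<lambda>f. (- 1) ^ d * F f) \<in> wspan a"
proof (cases "even d")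
  case False
  hence "(\<lambda>f. (- 1) ^ d * F f) = - F" by (simp add: fun_eq_iff)
  thus ?thesis using wspan_uminus[OF assms] by simp
qed (use assms in simp)

text \<open>The relation \<open>pivot_add_2\<close> is homogeneous when v_i has weight 2^i: 2^(k+1)
  + 2 * 2^k = 2^(k+2).\<close>

lemma pivot_in_wspan: "(pivot k :: 'k::field grassmann \<Rightarrow> _) \<in> wspan (2 ^ k)"
proof (induction k rule: induct_nat_012)
  case 0
  have "pivot 0 = monomial pivot [0]" by simp
  thus ?case unfolding wspan_def
    by (intro endo.span_base CollectI exI[of _ "[0]"]) (simp add: pivot_weight_def)
next
  case 1
  have "pivot 1 = monomial pivot [1]" by simp
  thus ?case unfolding wspan_def
    by (intro endo.span_base CollectI exI[of _ "[1]"]) (simp add: pivot_weight_def)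
next
  case (ge2 k)
  have "pivot (Suc (Suc k)) = (pivot (Suc k) \<circ> (pivot k \<circ> pivot k)) - (pivot k \<circ> (pivot k \<circ> pivot (Suc k)) :: 'k grassmann \<Rightarrow> _)"
    by (rule ext) (simp add: pivot_add_2[simplified])
  also have "\<dots> \<in> wspan (2 ^ Suc (Suc k))"
    using ge2 by (intro wspan_diff wspan_comp_le[of _ "2 ^ Suc k" _ "2 ^ k + 2 ^ k"]
        wspan_comp_le[of _ "2 ^ k" _ "2 ^ k + 2 ^ Suc k"] wspan_comp) simp_all
  finally show ?case .
qed

text \<open>Induction decides whether x_k occurs. If not, the commutator with v_k^2 turns v_(k+1)
  into v_(k+2); if it does, the signed anticommutator with v_k produces x_k v_(k+2).\<close>

lemma gbasis_pivot_in_wspan: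
  assumes "S \<subseteq> {..<k}"
  shows "(\<lambda>f :: 'k::field grassmann. gbasis S * pivot (k + 1) f) \<in> wspan (2 ^ (k + 1))"
  using assms
proof (induction k arbitrary: S)
  case 0
  thus ?case using pivot_in_wspan[of 1] by (simp add: gbasis_empty)
next
  case (Suc k)
  define T where "T = S - {k}"
  have T: "finite T" "T \<subseteq> {..<k}" using Suc.prems by (auto simp: T_def less_Suc_eq intro: finite_subset)
  define F :: "'k grassmann \<Rightarrow> 'k grassmann" where "F = (\<lambda>f. gbasis T * pivot (k + 1) f)"
  have F: "F \<in> wspan (2 ^ (k + 1))" unfolding F_def by (rule Suc.IH) (rule T)
  show ?case
  proof (cases "k \<in> S")
    case False
    hence "S = T" by (simp add: T_def)
    have "(\<lambda>f. gbasis S * pivot (Suc k + 1) f) = (F \<circ> (pivot k \<circ> pivot k)) - (pivot k \<circ> (pivot k \<circ> F))"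
    proof
      fix f :: "'k grassmann"
      \<comment> \<open>Passing x_T twice, v_k picks up the same sign twice.\<close>
      have "pivot k (pivot k (F f)) = gbasis T * pivot k (pivot k (pivot (k + 1) f))"
        using T by (cases "even (card T)") (simp_all add: F_def pivot_gbasis_mult pivot.neg)
      thus "gbasis S * pivot (Suc k + 1) f = ((F \<circ> (pivot k \<circ> pivot k)) - (pivot k \<circ> (pivot k \<circ> F))) f"
        using pivot_add_2[of k f] by (simp add: F_def \<open>S = T\<close> right_diff_distrib)
    qed
    also have "\<dots> \<in> wspan (2 ^ (Suc k + 1))"
      using F pivot_in_wspan[of k] by (intro wspan_diff wspan_comp_le[of _ "2 ^ (k + 1)" _ "2 ^ k + 2 ^ k"]
        wspan_comp_le[of _ "2 ^ k" _ "2 ^ k + 2 ^ (k + 1)"] wspan_comp) simp_all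
    finally show ?thesis .
  next
    case True
    hence "S = insert k T" by (auto simp: T_def)
    hence S: "gbasis S = gbasis T * (gen k :: 'k grassmann)" using T by (simp add: gbasis_insert_lt)
    have "(\<lambda>f. gbasis S * pivot (Suc k + 1) f) = - (F \<circ> pivot k) - (\<lambda>f. (- 1) ^ card T * (pivot k \<circ> F) f)"
    proof
      fix f :: "'k grassmann"
      have "gbasis T * (pivot k (pivot (k + 1) f) + pivot (k + 1) (pivot k f)) = - (gbasis S * pivot (k + 2) f)"
        unfolding pivot_anticommutator S by (simp add: mult.assoc)
      moreover have "(- 1) ^ card T * pivot k (F f) = gbasis T * pivot k (pivot (k + 1) f)"
        using T by (cases "even (card T)") (simp_all add: F_def pivot_gbasis_mult)
      ultimately show "gbasis S * pivot (Suc k + 1) f =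
          (- (F \<circ> pivot k) - (\<lambda>f. (- 1) ^ card T * (pivot k \<circ> F) f)) f"
        by (simp add: F_def distrib_left eq_neg_iff_add_eq_0 algebra_simps)
    qed
    also have "\<dots> \<in> wspan (2 ^ (Suc k + 1))"
      using F pivot_in_wspan[of k] by (intro wspan_diff wspan_uminus wspan_signed
        wspan_comp_le[of _ "2 ^ (k + 1)" _ "2 ^ k"] wspan_comp_le[of _ "2 ^ k" _ "2 ^ (k + 1)"]) simp_all
    finally show ?thesis .
  qed
qed

section \<open>The lower bound\<close>

text \<open>Independence is required of an indexed family, so that injectivity of
  \<open>\<phi>\<close> follows from it. Finiteness of \<open>S\<close> excludes infinite dimension,
  for which \<open>dim\<close> has the default value 0.\<close>

lemma (in vector_space) card_le_dim_span:
  assumes "finite I" "finite S" and sub: "\<phi> ` I \<subseteq> span S"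
    and indep: "\<And>c i. (\<Sum>i\<in>I. c i *s \<phi> i) = 0 \<Longrightarrow> i \<in> I \<Longrightarrow> c i = 0"
  shows "card I \<le> dim (span S)"
proof -
  have inj: "inj_on \<phi> I"
  proof (rule inj_onI, rule ccontr)
    fix i j assume ij: "i \<in> I" "j \<in> I" "\<phi> i = \<phi> j" "i \<noteq> j"
    \<comment> \<open>Two equal members would satisfy a nontrivial relation with coefficients 1 and
      -1.\<close>
    define c where "c = (\<lambda>l. if l = i then 1 else if l = j then - 1 else 0 :: 'a)"
    have "(\<Sum>l\<in>I. c l *s \<phi> l) = (\<Sum>l\<in>{i, j}. c l *s \<phi> l)"
      using ij \<open>finite I\<close> by (intro sum.mono_neutral_right) (auto simp: c_def)
    also have "\<dots> = 0" using ij by (simp add: c_def)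
    finally have "c i = 0" using indep ij by blast
    thus False by (simp add: c_def)
  qed
  have "independent (\<phi> ` I)"
  proof (rule independent_if_scalars_zero)
    fix f x assume "(\<Sum>x\<in>\<phi> ` I. f x *s x) = 0" "x \<in> \<phi> ` I"
    thus "f x = 0" using indep[of "f \<circ> \<phi>"] by (auto simp: sum.reindex[OF inj])
  qed (use \<open>finite I\<close> in simp)
  moreover obtain B where B: "B \<subseteq> S" "independent B" "S \<subseteq> span B" "card B = dim S"
    by (rule basis_exists)
  moreover have "span S \<subseteq> span B" using B(3) by (intro span_minimal subspace_span)
  moreover have "finite B" using B(1) \<open>finite S\<close> by (rule finite_subset)
  ultimately have "card (\<phi> ` I) \<le> card B"
    using independent_span_bound[of B "\<phi> ` I"] sub by simp
  thus ?thesis using B(4) by (simp add: card_image[OF inj])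
qed

lemma gbasis_mult_gen:
  assumes "finite Y" "i \<in> Y"
  shows "gbasis Y * (gen i * f) = (0 :: 'k::field grassmann)"
proof -
  have "gbasis Y * gen i = (0 :: 'k grassmann)" using assms by (simp add: gen_def gbasis_mult)
  thus ?thesis by (simp flip: mult.assoc)
qed

lemma pivot_one: "pivot i 1 = (0 :: 'k::field grassmann)"
proof -
  have "gderiv j 1 = (0 :: 'k grassmann)" for j by (simp add: gderiv_gbasis flip: gbasis_empty)
  thus ?thesis by (simp add: pivot_def)
qed

lemma gderiv_monomial_pivot:
  assumes "\<forall>j\<in>set w. i < j"
  shows "gderiv i (monomial pivot w f) = (- 1) ^ length w * monomial pivot w (gderiv i f)"
  using assms
proof (induction w)
  case (Cons j w)
  thus ?case by (cases "even (length w)") (simp_all add: gderiv_pivot pivot.neg)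
qed simp

text \<open>
  Multiplication by \<open>x\<^sub>0 \<cdots> x\<^bsub>k-1\<^esub>\<close> turns each \<open>v\<^sub>i\<close>, \<open>i < k\<close>, standing next to it into \<open>\<partial>\<^sub>i\<close>, which
  supercommutes with the pivot elements of larger index.
\<close>

lemma gbasis_pivot_monomial_eval:
  fixes k :: nat
  defines "Y \<equiv> {..<k}"
  assumes "sorted_wrt (<) w" "set w \<subseteq> Y" "C \<subseteq> Y"
  shows "\<exists>s. (s \<noteq> 0 \<longleftrightarrow> set w = C) \<and>
    gbasis Y * pivot (k + 1) (monomial pivot w (gbasis (insert (k + 1) C))) = s *\<^sub>G (gbasis Y :: 'k::field grassmann)"
  using assms(2-4)
proof (induction w arbitrary: C)
  case Nil
  hence C: "finite C" "C \<subseteq> {..<k + 1}" by (auto simp: Y_def intro: finite_subset)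
  \<comment> \<open>The letter x_(k+1) is in the test element so that v_(k+1) can consume
    it.\<close>
  have "pivot (k + 1) (gbasis (insert (k + 1) C)) = (- 1) ^ card C * (gbasis C :: 'k grassmann)"
    using C pivot_gen_mult_self[of "k + 1" "1 :: 'k grassmann"]
    by (simp add: gbasis_insert_lt pivot_gbasis_mult pivot_one)
  moreover have "gbasis Y * gbasis C = (0 :: 'k grassmann)" if "C \<noteq> {}"
    using that Nil C by (simp add: gbasis_mult Y_def Int_absorb1)
  ultimately show ?case
    by (cases "C = {}"; cases "even (card C)")
       (auto simp: gbasis_empty intro: exI[of _ "0 :: 'k"] exI[of _ "1 :: 'k"])
next
  case (Cons i w)
  have Y: "finite Y" "i \<in> Y" using Cons.prems by (simp_all add: Y_def)
  have lt: "\<forall>j\<in>set w. i < j" and i: "i < k" "i \<notin> set w" using Cons.prems by (auto simp: Y_def)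
  have fin: "finite C" using Cons.prems by (auto simp: Y_def intro: finite_subset)
  interpret M: Vector_Spaces.linear gscale gscale "monomial pivot w :: 'k grassmann \<Rightarrow> _"
    by (rule linear_monomial[OF pivot_linear])
  let ?x = "gbasis (insert (k + 1) C) :: 'k grassmann"
  \<comment> \<open>The first letter x_i of the tail of v_i moves past v_(k+1) and is absorbed by
    x_Y.\<close>
  have "gbasis Y * pivot (k + 1) (pivot i g) = gbasis Y * pivot (k + 1) (gderiv i g)" for g :: "'k grassmann"
    using Y i by (simp add: pivot_rec[of i] pivot.add pivot_gen_mult distrib_left mult.assoc gbasis_mult_gen)
  hence eq: "gbasis Y * pivot (k + 1) (monomial pivot (i # w) ?x)
      = (- 1) ^ length w * (gbasis Y * pivot (k + 1) (monomial pivot w (gderiv i ?x)))"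
    using lt by (cases "even (length w)") (simp_all add: gderiv_monomial_pivot pivot.neg)
  show ?case
  proof (cases "i \<in> C")
    case False
    hence "gderiv i ?x = 0" using fin i by (simp add: gderiv_gbasis)
    hence "gbasis Y * pivot (k + 1) (monomial pivot (i # w) ?x) = 0"
      unfolding eq by (simp add: M.zero pivot.zero)
    with False show ?thesis by (intro exI[of _ 0]) auto
  next
    case True
    define D where "D = C - {i}"
    have "insert (k + 1) C - {i} = insert (k + 1) D" using i by (auto simp: D_def)
    hence "gderiv i ?x = gsign {i} (insert (k + 1) D) *\<^sub>G gbasis (insert (k + 1) D)"
      using fin i True by (simp add: gderiv_gbasis)
    moreover obtain s :: 'k where "s \<noteq> 0 \<longleftrightarrow> set w = D" and
      s: "gbasis Y * pivot (k + 1) (monomial pivot w (gbasis (insert (k + 1) D))) = s *\<^sub>G gbasis Y"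
      using Cons.IH[of D] Cons.prems by (auto simp: D_def)
    ultimately have "gbasis Y * pivot (k + 1) (monomial pivot (i # w) ?x)
        = ((- 1) ^ length w * gsign {i} (insert (k + 1) D) * s) *\<^sub>G gbasis Y"
      unfolding eq by (cases "even (length w)") (simp_all add: M.scale pivot.scale gscale_mult_right)
    moreover have "gsign {i} (insert (k + 1) D) \<noteq> (0 :: 'k)"
      using gsign_square[of "{i}" "insert (k + 1) D", where 'a = 'k] by (metis mult_zero_left zero_neq_one)
    moreover have "set w = D \<longleftrightarrow> set (i # w) = C" using i True by (auto simp: D_def)
    ultimately show ?thesis
      using \<open>s \<noteq> 0 \<longleftrightarrow> set w = D\<close>
      by (intro exI[of _ "(- 1) ^ length w * gsign {i} (insert (k + 1) D) * s"]) simp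
  qed
qed

text \<open>The increasing order of the v_i matters: the derivative replacing the leftmost one has
  the smallest index and so passes all the others.\<close>

definition pivot_word :: "nat \<Rightarrow> nat set \<times> nat set \<Rightarrow> 'k::field grassmann \<Rightarrow> 'k grassmann" where
  "pivot_word k p = (\<lambda>f. gbasis (fst p) * pivot (k + 1) f) \<circ> monomial pivot (sorted_list_of_set (snd p))"

text \<open>A triangularity argument: among the pairs with nonzero coefficient take p = (A, B) with
  A of least size, multiply by the complementary x_(Y - A) and evaluate at x_B x_(k+1). Only the
  term of p survives.\<close>

lemma pivot_words_independent:
  fixes c :: "nat set \<times> nat set \<Rightarrow> 'k::field"
  assumes sum0: "(\<Sum>p\<in>Pow {..<k} \<times> Pow {..<k}. escale (c p) (pivot_word k p)) = 0"
    and q: "q \<in> Pow {..<k} \<times> Pow {..<k}"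
  shows "c q = 0"
proof (rule ccontr)
  let ?I = "Pow {..<k} \<times> Pow {..<k}" and ?Y = "{..<k}"
  assume "c q \<noteq> 0"
  with q have "q \<in> ?I \<and> c q \<noteq> 0" by simp
  then obtain p where p: "p \<in> ?I" "c p \<noteq> 0"
    and min: "\<And>r. r \<in> ?I \<Longrightarrow> c r \<noteq> 0 \<Longrightarrow> card (fst p) \<le> card (fst r)"
    by (metis ex_has_least_nat[of "\<lambda>p. p \<in> ?I \<and> c p \<noteq> 0" q "card \<circ> fst"] comp_apply)
  obtain A B where AB: "p = (A, B)" "A \<subseteq> ?Y" "B \<subseteq> ?Y" using p by auto
  have fin: "finite S" if "S \<subseteq> ?Y" for S using that finite_subset by blast
  let ?x = "gbasis (insert (k + 1) B) :: 'k grassmann"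
  define g where "g r = c r *\<^sub>G (gbasis (?Y - A) * pivot_word k r ?x)" for r
  have apply_sum: "(\<Sum>p\<in>J. escale (c p) (pivot_word k p)) f = (\<Sum>p\<in>J. c p *\<^sub>G pivot_word k p f)" for f J
    by (induction J rule: infinite_finite_induct) (simp_all add: escale_def)
  have "(\<Sum>r\<in>?I. g r) = gbasis (?Y - A) * (\<Sum>p\<in>?I. escale (c p) (pivot_word k p)) ?x"
    unfolding apply_sum g_def by (simp add: sum_distrib_left gscale_mult_right)
  also have "\<dots> = 0" unfolding sum0 by simp
  finally have sum_g: "(\<Sum>r\<in>?I. g r) = 0" .
  have eval: "\<exists>s. (s \<noteq> 0 \<longleftrightarrow> r = p) \<and> g r = s *\<^sub>G gbasis ?Y" if r: "r \<in> ?I" for r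
  proof (cases "c r = 0")
    case True
    with p show ?thesis by (intro exI[of _ 0]) (auto simp: g_def)
  next
    case False
    obtain S T where ST: "r = (S, T)" "S \<subseteq> ?Y" "T \<subseteq> ?Y" using r by auto
    let ?h = "pivot (k + 1) (monomial pivot (sorted_list_of_set T) ?x)"
    have g: "g r = c r *\<^sub>G (gbasis (?Y - A) * gbasis S * ?h)"
      by (simp add: g_def pivot_word_def ST mult.assoc)
    show ?thesis
    proof (cases "S = A")
      case False
      have "card A \<le> card S" using min[OF r \<open>c r \<noteq> 0\<close>] by (simp add: AB ST)
      \<comment> \<open>By minimality S is no proper subset of A, so it meets the complement and the
        product has a repeated letter.\<close>
      hence "\<not> S \<subseteq> A" using False fin AB by (metis card_seteq)
      hence "(?Y - A) \<inter> S \<noteq> {}" using ST by auto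
      hence "g r = 0" unfolding g using fin ST by (simp add: gbasis_mult)
      moreover have "r \<noteq> p" using False by (simp add: AB ST)
      ultimately show ?thesis by (intro exI[of _ 0]) auto
    next
      case True
      obtain s where s: "s \<noteq> 0 \<longleftrightarrow> T = B" "gbasis ?Y * ?h = s *\<^sub>G gbasis ?Y"
        using gbasis_pivot_monomial_eval[of "sorted_list_of_set T" k B] fin AB ST by auto
      have "(?Y - A) \<union> A = ?Y" "(?Y - A) \<inter> A = {}" using AB by auto
      hence "gbasis (?Y - A) * gbasis S = gsign (?Y - A) A *\<^sub>G (gbasis ?Y :: 'k grassmann)"
        using fin AB by (simp add: gbasis_mult True)
      hence "g r = (c r * gsign (?Y - A) A * s) *\<^sub>G gbasis ?Y"
        unfolding g by (simp add: gscale_mult_left s(2)[unfolded Suc_eq_plus1[symmetric]] mult.assoc)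
      moreover have "gsign (?Y - A) A \<noteq> (0 :: 'k)"
        using gsign_square[of "?Y - A" A, where 'a = 'k] by (metis mult_zero_left zero_neq_one)
      moreover have "T = B \<longleftrightarrow> r = p" using True by (simp add: AB ST)
      ultimately show ?thesis
        using s(1) \<open>c r \<noteq> 0\<close> by (intro exI[of _ "c r * gsign (?Y - A) A * s"]) simp
    qed
  qed
  have "g r = 0" if "r \<in> ?I - {p}" for r using eval[of r] that by auto
  hence "(\<Sum>r\<in>?I. g r) = (\<Sum>r\<in>{p}. g r)"
    using p by (intro sum.mono_neutral_right) blast+
  with sum_g have "g p = 0" by simp
  moreover obtain s where "s \<noteq> 0" "g p = s *\<^sub>G gbasis ?Y" using eval[OF p(1)] by blast
  moreover have "gbasis ?Y \<noteq> (0 :: 'k grassmann)"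
    by (metis finite_lessThan gcoeff_0 gcoeff_basis zero_neq_one)
  ultimately show False by simp
qed

text \<open>x_A v_(k+1) costs 2^(k+1), and the v_i with i in B together cost at most 2^k.\<close>

lemma pivot_word_in_wspan:
  assumes "p \<in> Pow {..<k} \<times> Pow {..<k}"
  shows "pivot_word k p \<in> wspan (2 ^ (k + 2))"
proof -
  have comp: "F \<circ> monomial pivot w \<in> wspan (a + (\<Sum>i\<leftarrow>w. 2 ^ i))"
    if "F \<in> wspan a" for F :: "'a grassmann \<Rightarrow> 'a grassmann" and a w
    using that
  proof (induction w arbitrary: F a)
    case (Cons i w)
    from Cons.IH[OF wspan_comp[OF Cons.prems pivot_in_wspan[of i]]] show ?case
      by (simp add: comp_assoc add.assoc)
  qed simp
  obtain A B where p: "p = (A, B)" "A \<subseteq> {..<k}" "B \<subseteq> {..<k}" using assms by auto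
  have "finite B" using p finite_subset by blast
  hence "(\<Sum>i\<leftarrow>sorted_list_of_set B. 2 ^ i) = (\<Sum>i\<in>B. 2 ^ i :: nat)"
    using sum_list_distinct_conv_sum_set[of "sorted_list_of_set B" "\<lambda>i. 2 ^ i :: nat"] by simp
  also have "\<dots> \<le> (\<Sum>i<k. 2 ^ i)" using p by (intro sum_mono2) auto
  also have "\<dots> \<le> 2 ^ k" by (induction k) auto
  finally have "2 ^ (k + 1) + (\<Sum>i\<leftarrow>sorted_list_of_set B. 2 ^ i) \<le> (2 ^ (k + 2) :: nat)" by simp
  from wspan_mono[OF this] comp[OF gbasis_pivot_in_wspan[OF p(2)]] show ?thesis
    unfolding pivot_word_def p(1) fst_conv snd_conv by blast
qed

section \<open>Finiteness and the dimension count\<close>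

lemma finite_weighted_words:
  "finite {w \<in> lists {0, 1}. sum_list (map pivot_weight w) \<le> m}"
proof (rule finite_subset)
  have "length w \<le> sum_list (map pivot_weight w)" for w
    by (induction w) (auto simp: pivot_weight_def)
  thus "{w \<in> lists {0, 1}. sum_list (map pivot_weight w) \<le> m} \<subseteq> {w. set w \<subseteq> {0, 1} \<and> length w \<le> m}"
    by (auto intro: order_trans)
qed (intro finite_lists_length_le, simp)

lemma weight_growth_pivot:
  "weight_growth {0, 1} pivot_weight (pivot :: nat \<Rightarrow> 'k::field grassmann \<Rightarrow> _) m =
    endo.dim (wspan m :: ('k grassmann \<Rightarrow> _) set)"
  by (simp only: weight_growth_def wspan_def)

lemma finite_wspan_monomials:
  "finite {monomial pivot w | w. w \<in> lists {0, 1} \<and> w \<noteq> [] \<and> sum_list (map pivot_weight w) \<le> m}"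
  by (rule finite_subset[OF _ finite_imageI[OF finite_weighted_words[of m], of "monomial pivot"]]) auto

lemma weight_growth_ge_power:
  "4 ^ k \<le> weight_growth {0, 1} pivot_weight (pivot :: nat \<Rightarrow> 'k::field grassmann \<Rightarrow> _) (2 ^ (k + 2))"
proof -
  have "card (Pow {..<k} \<times> Pow {..<k}) \<le> endo.dim (wspan (2 ^ (k + 2)) :: ('k grassmann \<Rightarrow> _) set)"
    unfolding wspan_def
  proof (rule endo.card_le_dim_span)
    show "pivot_word k ` (Pow {..<k} \<times> Pow {..<k}) \<subseteq>
      endo.span {monomial pivot w :: 'k grassmann \<Rightarrow> _ | w.
        w \<in> lists {0, 1} \<and> w \<noteq> [] \<and> sum_list (map pivot_weight w) \<le> 2 ^ (k + 2)}"
      using pivot_word_in_wspan unfolding wspan_def by blast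
  qed (simp, rule finite_wspan_monomials, rule pivot_words_independent)
  moreover have "card (Pow {..<k} \<times> Pow {..<k}) = 4 ^ k"
    by (simp add: card_cartesian_product card_Pow flip: power_mult_distrib)
  ultimately show ?thesis by (simp only: weight_growth_pivot)
qed

section \<open>The upper bound\<close>

text \<open>Exponents are Booleans because x_n and \<partial>_n square to zero.\<close>

definition gen_pow :: "nat \<Rightarrow> bool \<Rightarrow> 'k::field grassmann \<Rightarrow> 'k grassmann" where
  "gen_pow n a = (if a then (\<lambda>f. gen n * f) else id)"

definition gderiv_pow :: "nat \<Rightarrow> bool \<Rightarrow> 'k::field grassmann \<Rightarrow> 'k grassmann" where
  "gderiv_pow n b = (if b then gderiv n else id)"

abbreviation word_weight :: "nat list \<Rightarrow> nat" where
  "word_weight u \<equiv> sum_list (map pivot_weight u)"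

text \<open>
  The words in \<open>v\<^sub>n, v\<^bsub>n+1\<^esub>\<close> alone are not spanned by words in \<open>v\<^bsub>n+1\<^esub>, v\<^bsub>n+2\<^esub>\<close> with
  prefixes in \<open>x\<^sub>n, \<partial>\<^sub>n\<close>, since \<open>v\<^sub>n = \<partial>\<^sub>n + x\<^sub>n x\<^bsub>n+1\<^esub> v\<^bsub>n+2\<^esub>\<close>: the letter \<open>x\<^bsub>n+1\<^esub>\<close> has to be admitted too.
\<close>

definition tail_word :: "nat \<Rightarrow> bool \<Rightarrow> nat list \<Rightarrow> 'k::field grassmann \<Rightarrow> 'k grassmann" where
  "tail_word n e u = gen_pow n e \<circ> monomial (\<lambda>i. pivot (n + i)) u"

text \<open>Here \<open>c\<close> bounds absolute weight, with wt(v_n) = 2^n. The negative weight of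
  x_n is moved to the right-hand side to stay within the naturals.\<close>

definition tail_words :: "nat \<Rightarrow> nat \<Rightarrow> ('k::field grassmann \<Rightarrow> 'k grassmann) set" where
  "tail_words n c = {tail_word n e u | e u. u \<in> lists {0, 1} \<and> 2 ^ n * word_weight u \<le> c + (if e then 2 ^ n else 0)}"

text \<open>Weights are counted in units of \<open>wt(v\<^sub>n) = 2\<^sup>n\<close>.\<close>

definition prefixed_words :: "nat \<Rightarrow> int \<Rightarrow> ('k::field grassmann \<Rightarrow> 'k grassmann) set" where
  "prefixed_words n k = {gen_pow n a \<circ> (gderiv_pow n b \<circ> tail_word (n + 1) e u) | a b e u.
     u \<in> lists {0, 1} \<and> of_bool b - of_bool a + 2 * (int (word_weight u) - of_bool e) \<le> k}"

lemma linear_gen_pow: "Vector_Spaces.linear gscale gscale (gen_pow n a)"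
  by (auto simp: gen_pow_def id_def grassmann.linear_ident Vector_Spaces.linear_iff
      grassmann.vector_space_axioms distrib_left gscale_mult_right)

lemma linear_gderiv_pow: "Vector_Spaces.linear gscale gscale (gderiv_pow n b)"
  by (auto simp: gderiv_pow_def id_def grassmann.linear_ident gderiv.linear_axioms)

lemma prefixed_wordsI:
  assumes "u \<in> lists {0, 1}" "of_bool b - of_bool a + 2 * (int (word_weight u) - of_bool e) \<le> k"
    "F = gen_pow n a \<circ> (gderiv_pow n b \<circ> tail_word (n + 1) e u)"
  shows "F \<in> endo.span (prefixed_words n k)"
  using assms unfolding prefixed_words_def by (intro endo.span_base) blast

section \<open>Left multiplication of prefixed words by x_n, \<partial>_n, v_n and v_(n+1)\<close>

lemma gen_comp_prefixed_word:
  assumes "F \<in> prefixed_words n k"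
  shows "gen_pow n True \<circ> F \<in> endo.span (prefixed_words n (k - 1))"
proof -
  obtain a b e u where u: "u \<in> lists {0, 1}" "of_bool b - of_bool a + 2 * (int (word_weight u) - of_bool e) \<le> k"
    and F: "F = gen_pow n a \<circ> (gderiv_pow n b \<circ> tail_word (n + 1) e u)"
    using assms unfolding prefixed_words_def by blast
  show ?thesis
  proof (cases a)
    case True
    hence "gen_pow n True \<circ> F = 0" by (simp add: F gen_pow_def fun_eq_iff)
    thus ?thesis by (simp only: endo.span_zero)
  next
    case False
    show ?thesis
      by (rule prefixed_wordsI[of u b True e]) (use u False in \<open>simp_all add: F gen_pow_def\<close>)
  qed
qed

text \<open>Normal ordering by the Clifford relation \<partial>_n x_n = 1 - x_n \<partial>_n and
  \<partial>_n^2 = 0.\<close>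

lemma gderiv_comp_prefixed_word:
  fixes F :: "'k::field grassmann \<Rightarrow> 'k grassmann"
  assumes "F \<in> prefixed_words n k"
  shows "gderiv n \<circ> F \<in> endo.span (prefixed_words n (k + 1))"
proof -
  obtain a b e u where u: "u \<in> lists {0, 1}" "of_bool b - of_bool a + 2 * (int (word_weight u) - of_bool e) \<le> k"
    and F: "F = gen_pow n a \<circ> (gderiv_pow n b \<circ> tail_word (n + 1) e u)"
    using assms unfolding prefixed_words_def by blast
  let ?w = "\<lambda>a b. gen_pow n a \<circ> (gderiv_pow n b \<circ> tail_word (n + 1) e u) :: 'k grassmann \<Rightarrow> 'k grassmann"
  have mem: "?w a' b' \<in> endo.span (prefixed_words n (k + 1))"
    if "of_bool b' - of_bool a' \<le> (of_bool b - of_bool a + 1 :: int)" for a' b'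
    by (rule prefixed_wordsI[of u b' a' e]) (use u that in simp_all)
  consider "\<not> a" "\<not> b" | "\<not> a" "b" | "a" "\<not> b" | "a" "b" by blast
  thus ?thesis
  proof cases
    case 1
    hence "gderiv n \<circ> F = ?w False True" by (simp add: F gen_pow_def gderiv_pow_def)
    thus ?thesis using mem[of True False] 1 by (simp only:) simp
  next
    case 2
    hence "gderiv n \<circ> F = 0" by (simp add: F gen_pow_def gderiv_pow_def fun_eq_iff)
    thus ?thesis by (simp only: endo.span_zero)
  next
    case 3
    hence "gderiv n \<circ> F = ?w False False - ?w True True"
      by (simp add: F gen_pow_def gderiv_pow_def fun_eq_iff gderiv_gen_mult)
    thus ?thesis using mem[of False False] mem[of True True] 3 by (simp add: endo.span_diff)
  next
    case 4
    hence "gderiv n \<circ> F = ?w False True"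
      by (simp add: F gen_pow_def gderiv_pow_def fun_eq_iff gderiv_gen_mult)
    thus ?thesis using mem[of True False] 4 by (simp only:) simp
  qed
qed

lemma pivot_comp_prefixed_word:
  fixes F :: "'k::field grassmann \<Rightarrow> 'k grassmann"
  assumes "F \<in> prefixed_words n k"
  shows "pivot n \<circ> F \<in> endo.span (prefixed_words n (k + 1))"
proof -
  obtain a b e u where u: "u \<in> lists {0, 1}" "of_bool b - of_bool a + 2 * (int (word_weight u) - of_bool e) \<le> k"
    and F: "F = gen_pow n a \<circ> (gderiv_pow n b \<circ> tail_word (n + 1) e u)"
    using assms unfolding prefixed_words_def by blast
  \<comment> \<open>\<open>Q\<close> is the contribution of the tail of v_n. It vanishes if x_n or
    x_(n+1) is already present; otherwise it inserts both and v_(n+2), changing the weight by -1 - 2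
    + 4 = 1.\<close>
  define Q where "Q = (\<lambda>f. gen n * (gen (n + 1) * pivot (n + 2) (F f)))"
  have "Q \<in> endo.span (prefixed_words n (k + 1))"
  proof (cases "a \<or> e")
    case True
    have "gen n * (gen (Suc n) * (gen n * g)) = 0" for g :: "'k grassmann"
      by (simp add: gen_left_commute[of n "Suc n"])
    hence "Q = 0" using True
      by (auto simp: Q_def F gen_pow_def gderiv_pow_def tail_word_def fun_eq_iff pivot_gen_mult
          gderiv_gen_mult pivot.neg)
    thus ?thesis by (simp only: endo.span_zero)
  next
    case False
    hence "Q = gen_pow n True \<circ> (gderiv_pow n b \<circ> tail_word (n + 1) True (1 # u))"
      by (auto simp: Q_def F gen_pow_def gderiv_pow_def tail_word_def fun_eq_iff gderiv_gen_mult gderiv_pivot)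
    thus ?thesis
      by (rule prefixed_wordsI[rotated 2]) (use u False in \<open>simp_all add: pivot_weight_def\<close>)
  qed
  moreover have "pivot n \<circ> F = (gderiv n \<circ> F) + Q"
    by (simp add: fun_eq_iff Q_def pivot_rec[of n] mult.assoc)
  ultimately show ?thesis using gderiv_comp_prefixed_word[OF assms] by (simp only: endo.span_add)
qed

lemma pivot_Suc_comp_prefixed_word:
  fixes F :: "'k::field grassmann \<Rightarrow> 'k grassmann"
  assumes "F \<in> prefixed_words n k"
  shows "pivot (n + 1) \<circ> F \<in> endo.span (prefixed_words n (k + 2))"
proof -
  obtain a b e u where u: "u \<in> lists {0, 1}" "of_bool b - of_bool a + 2 * (int (word_weight u) - of_bool e) \<le> k"
    and F: "F = gen_pow n a \<circ> (gderiv_pow n b \<circ> tail_word (n + 1) e u)"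
    using assms unfolding prefixed_words_def by blast
  let ?w = "\<lambda>e u. gen_pow n a \<circ> (gderiv_pow n b \<circ> tail_word (n + 1) e u) :: 'k grassmann \<Rightarrow> 'k grassmann"
  define G where "G = gen_pow n a \<circ> (gderiv_pow n b \<circ> (pivot (n + 1) \<circ> tail_word (n + 1) e u :: 'k grassmann \<Rightarrow> _))"
  \<comment> \<open>v_(n+1) changes sign once for each of x_n and \<partial>_n that it
    passes.\<close>
  have "pivot (n + 1) \<circ> F = (if a = b then G else - G)"
    by (auto simp: F G_def gen_pow_def gderiv_pow_def fun_eq_iff pivot_gen_mult gderiv_pivot)
  moreover have "G \<in> endo.span (prefixed_words n (k + 2))"
  proof (cases e)
    case False
    hence "G = ?w False (0 # u)"
      by (simp add: G_def tail_word_def gen_pow_def)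
    thus ?thesis
      by (rule prefixed_wordsI[rotated 2]) (use u False in \<open>simp_all add: pivot_weight_def\<close>)
  next
    case True
    hence "G = ?w False u - ?w True (0 # u)"
      by (auto simp: G_def tail_word_def gen_pow_def gderiv_pow_def fun_eq_iff pivot_gen_mult_self
          gderiv.diff right_diff_distrib)
    moreover have "?w False u \<in> endo.span (prefixed_words n (k + 2))"
      by (rule prefixed_wordsI[OF _ _ refl]) (use u True in simp_all)
    moreover have "?w True (0 # u) \<in> endo.span (prefixed_words n (k + 2))"
      by (rule prefixed_wordsI[OF _ _ refl]) (use u True in \<open>simp_all add: pivot_weight_def\<close>)
    ultimately show ?thesis by (simp only: endo.span_diff)
  qed
  ultimately show ?thesis using endo.span_neg by (cases "a = b") simp_all
qed

text \<open>Letters are attached from the left: v_n raises the weight by 1, v_(n+1) by 2, and a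
  leading x_n lowers it by 1.\<close>

lemma tail_word_in_span:
  assumes "u \<in> lists {0, 1}"
  shows "(tail_word n e u :: 'k::field grassmann \<Rightarrow> _) \<in> endo.span (prefixed_words n (int (word_weight u) - of_bool e))"
proof -
  have mono: "monomial (\<lambda>i. pivot (n + i)) u \<in> endo.span (prefixed_words n (int (word_weight u)) :: ('k grassmann \<Rightarrow> _) set)"
    using assms
  proof (induction u)
    case Nil
    show ?case
      by (rule prefixed_wordsI[of "[]" False False False])
         (simp_all add: gen_pow_def gderiv_pow_def tail_word_def fun_eq_iff)
  next
    case (Cons i u)
    show ?case
    proof (cases "i = 0")
      case True
      have "pivot n \<circ> monomial (\<lambda>i. pivot (n + i)) u \<in> endo.span (prefixed_words n (int (word_weight u) + 1) :: ('k grassmann \<Rightarrow> _) set)"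
        by (rule comp_in_span_left[OF pivot_linear Cons.IH pivot_comp_prefixed_word])
      moreover have "monomial (\<lambda>i. pivot (n + i)) (i # u) = (pivot n \<circ> monomial (\<lambda>i. pivot (n + i)) u :: 'k grassmann \<Rightarrow> _)"
        "int (word_weight (i # u)) = int (word_weight u) + 1"
        using True by (simp_all add: fun_eq_iff pivot_weight_def[of 0])
      ultimately show ?thesis by (simp only:)
    next
      case False
      have "pivot (n + 1) \<circ> monomial (\<lambda>i. pivot (n + i)) u \<in> endo.span (prefixed_words n (int (word_weight u) + 2) :: ('k grassmann \<Rightarrow> _) set)"
        by (rule comp_in_span_left[OF pivot_linear Cons.IH pivot_Suc_comp_prefixed_word])
      moreover have "i = 1" using False Cons.hyps by auto
      hence "monomial (\<lambda>i. pivot (n + i)) (i # u) = (pivot (n + 1) \<circ> monomial (\<lambda>i. pivot (n + i)) u :: 'k grassmann \<Rightarrow> _)"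
        "int (word_weight (i # u)) = int (word_weight u) + 2"
        by (simp_all add: fun_eq_iff pivot_weight_def[of "Suc 0"])
      ultimately show ?thesis by (simp only:)
    qed
  qed
  show ?thesis
  proof (cases e)
    case True
    have "gen_pow n True \<circ> monomial (\<lambda>i. pivot (n + i)) u \<in> endo.span (prefixed_words n (int (word_weight u) - 1) :: ('k grassmann \<Rightarrow> _) set)"
      by (rule comp_in_span_left[OF linear_gen_pow mono gen_comp_prefixed_word])
    thus ?thesis using True by (simp add: tail_word_def)
  next
    case False
    thus ?thesis using mono by (simp add: tail_word_def gen_pow_def)
  qed
qed

definition prefix_all :: "nat \<Rightarrow> ('k::field grassmann \<Rightarrow> 'k grassmann) set \<Rightarrow> ('k grassmann \<Rightarrow> 'k grassmann) set" where
  "prefix_all n T = (\<lambda>((a, b), F). gen_pow n a \<circ> (gderiv_pow n b \<circ> F)) ` (UNIV \<times> T)"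

lemma tail_words_subset_span:
  "(tail_words n c :: ('k::field grassmann \<Rightarrow> _) set) \<subseteq> endo.span (prefix_all n (tail_words (n + 1) (c + 2 ^ n)))"
proof
  fix F :: "'k grassmann \<Rightarrow> 'k grassmann" assume "F \<in> tail_words n c"
  then obtain e u where F: "F = tail_word n e u" "u \<in> lists {0, 1}"
    and c: "2 ^ n * word_weight u \<le> c + (if e then 2 ^ n else 0)"
    unfolding tail_words_def by blast
  define k where "k = int (word_weight u) - of_bool e"
  have k: "2 ^ n * k \<le> int c"
  proof -
    have "int (2 ^ n * word_weight u) \<le> int (c + (if e then 2 ^ n else 0))" using c by (simp only: of_nat_le_iff)
    thus ?thesis by (simp add: k_def right_diff_distrib split: if_splits)
  qed
  have "prefixed_words n k \<subseteq> (prefix_all n (tail_words (n + 1) (c + 2 ^ n)) :: ('k grassmann \<Rightarrow> _) set)"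
  proof
    fix G :: "'k grassmann \<Rightarrow> 'k grassmann" assume "G \<in> prefixed_words n k"
    then obtain a b e' u' where G: "G = gen_pow n a \<circ> (gderiv_pow n b \<circ> tail_word (n + 1) e' u')" "u' \<in> lists {0, 1}"
      and le: "of_bool b - of_bool a + 2 * (int (word_weight u') - of_bool e') \<le> k"
      unfolding prefixed_words_def by blast
    \<comment> \<open>The prefix has weight at least -1, attained by x_n alone; this is the source
      of the summand 2^n in the new bound.\<close>
    have "2 * (int (word_weight u') - of_bool e') \<le> k + 1" using le by (auto split: if_splits simp: of_bool_def)
    hence "2 ^ n * (2 * (int (word_weight u') - of_bool e')) \<le> 2 ^ n * (k + 1)" by (intro mult_left_mono) auto
    also have "\<dots> \<le> int (c + 2 ^ n)" using k by (simp add: distrib_left)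
    finally have "int (2 ^ (n + 1) * word_weight u') \<le> int (c + 2 ^ n + (if e' then 2 ^ (n + 1) else 0))"
      by (cases e') (simp_all add: algebra_simps)
    hence "2 ^ (n + 1) * word_weight u' \<le> c + 2 ^ n + (if e' then 2 ^ (n + 1) else 0)"
      by (simp only: of_nat_le_iff)
    hence "tail_word (n + 1) e' u' \<in> (tail_words (n + 1) (c + 2 ^ n) :: ('k grassmann \<Rightarrow> _) set)"
      using G(2) unfolding tail_words_def by blast
    thus "G \<in> prefix_all n (tail_words (n + 1) (c + 2 ^ n))"
      unfolding prefix_all_def G(1) by (intro image_eqI[of _ _ "((a, b), tail_word (n + 1) e' u')"]) simp_all
  qed
  thus "F \<in> endo.span (prefix_all n (tail_words (n + 1) (c + 2 ^ n)))"
    using tail_word_in_span[OF F(2), of n e] endo.span_mono unfolding F(1) k_def by blast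
qed

lemma finite_tail_words: "finite (tail_words n c)"
proof -
  have "word_weight u \<le> c + 1" if "2 ^ n * word_weight u \<le> c + (if e then 2 ^ n else 0)" for e u
  proof -
    have "2 ^ n * (word_weight u - 1) \<le> c"
      using that by (simp add: diff_mult_distrib2 split: if_splits)
    moreover have "word_weight u - 1 \<le> 2 ^ n * (word_weight u - 1)" by simp
    ultimately show ?thesis by linarith
  qed
  hence "tail_words n c \<subseteq> (\<lambda>(e, u). tail_word n e u) ` (UNIV \<times> {u \<in> lists {0, 1}. word_weight u \<le> c + 1})"
    unfolding tail_words_def by fastforce
  thus ?thesis
    by (rule finite_subset) (intro finite_imageI finite_cartesian_product finite_weighted_words finite)
qed

text \<open>Each of j steps multiplies the number of operators by the 4 prefixes and raises the
  weight bound, in total by 2^n + ... + 2^(n+j-1) = 2^(n+j) - 2^n.\<close>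

lemma tail_words_spanning_set:
  assumes "2 ^ (n + j) + c \<le> d + 2 ^ n"
  shows "\<exists>T. finite T \<and> card T \<le> 4 ^ j * card (tail_words (n + j) d :: ('k::field grassmann \<Rightarrow> _) set) \<and>
    (tail_words n c :: ('k grassmann \<Rightarrow> _) set) \<subseteq> endo.span T"
  using assms
proof (induction j arbitrary: n c)
  case 0
  hence "c \<le> d" by simp
  hence "tail_words n c \<subseteq> (tail_words n d :: ('k grassmann \<Rightarrow> _) set)"
    unfolding tail_words_def by (blast intro: order_trans add_right_mono)
  also have "\<dots> \<subseteq> endo.span (tail_words n d)" by (rule endo.span_superset)
  finally show ?case using finite_tail_words by (intro exI[of _ "tail_words n d"]) simp
next
  case (Suc j)
  have "2 ^ (n + 1 + j) + (c + 2 ^ n) \<le> d + 2 ^ (n + 1)" using Suc.prems by simp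
  from Suc.IH[OF this] obtain T :: "('k grassmann \<Rightarrow> 'k grassmann) set" where T: "finite T"
    "card T \<le> 4 ^ j * card (tail_words (n + 1 + j) d :: ('k grassmann \<Rightarrow> _) set)"
    "tail_words (n + 1) (c + 2 ^ n) \<subseteq> endo.span T" by blast
  have "prefix_all n (tail_words (n + 1) (c + 2 ^ n)) \<subseteq> endo.span (prefix_all n T)"
  proof
    fix G :: "'k grassmann \<Rightarrow> 'k grassmann" assume "G \<in> prefix_all n (tail_words (n + 1) (c + 2 ^ n))"
    then obtain a b F where G: "G = (gen_pow n a \<circ> gderiv_pow n b) \<circ> F" "F \<in> tail_words (n + 1) (c + 2 ^ n)"
      unfolding prefix_all_def by (auto simp: comp_assoc)
    have "Vector_Spaces.linear gscale gscale (gen_pow n a \<circ> gderiv_pow n b :: 'k grassmann \<Rightarrow> _)"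
      by (rule Vector_Spaces.linear_compose[OF linear_gderiv_pow linear_gen_pow])
    moreover have "F \<in> endo.span T" using G T by blast
    ultimately show "G \<in> endo.span (prefix_all n T)"
      unfolding G(1)
    proof (rule comp_in_span_left)
      fix H assume "H \<in> T"
      hence "gen_pow n a \<circ> (gderiv_pow n b \<circ> H) \<in> prefix_all n T"
        unfolding prefix_all_def by (intro image_eqI[of _ _ "((a, b), H)"]) simp_all
      thus "(gen_pow n a \<circ> gderiv_pow n b) \<circ> H \<in> endo.span (prefix_all n T)"
        unfolding comp_assoc by (rule endo.span_base)
    qed
  qed
  hence "endo.span (prefix_all n (tail_words (n + 1) (c + 2 ^ n))) \<subseteq> endo.span (prefix_all n T)"
    by (intro endo.span_minimal endo.subspace_span)
  hence "tail_words n c \<subseteq> endo.span (prefix_all n T)" using tail_words_subset_span by blast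
  moreover have "finite (prefix_all n T)" using T(1) unfolding prefix_all_def by simp
  moreover have "card (prefix_all n T) \<le> 4 ^ Suc j * card (tail_words (n + Suc j) d :: ('k grassmann \<Rightarrow> _) set)"
  proof -
    have "card (prefix_all n T) \<le> card ((UNIV :: (bool \<times> bool) set) \<times> T)"
      using T(1) unfolding prefix_all_def by (intro card_image_le) simp
    also have "\<dots> = 4 * card T" by (simp add: card_cartesian_product card_UNIV_bool flip: UNIV_Times_UNIV)
    finally show ?thesis using T(2) by simp
  qed
  ultimately show ?case by blast
qed

text \<open>The weight allows words of length at most 3: 1 + 2 + 4 + 8 = 15 words, each with or
  without x_n.\<close>

lemma card_tail_words_le:
  "card (tail_words n (2 * 2 ^ n) :: ('k::field grassmann \<Rightarrow> _) set) \<le> 30"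
proof -
  let ?W = "{u. set u \<subseteq> {0, 1 :: nat} \<and> length u \<le> 3}"
  have len: "length u \<le> word_weight u" for u
    by (induction u) (auto simp: pivot_weight_def)
  have "tail_words n (2 * 2 ^ n) \<subseteq> (\<lambda>(e, u). tail_word n e u :: 'k grassmann \<Rightarrow> _) ` (UNIV \<times> ?W)"
  proof
    fix F :: "'k grassmann \<Rightarrow> 'k grassmann" assume "F \<in> tail_words n (2 * 2 ^ n)"
    then obtain e u where F: "F = tail_word n e u" "u \<in> lists {0, 1}"
      and "2 ^ n * word_weight u \<le> 2 * 2 ^ n + (if e then 2 ^ n else 0)"
      unfolding tail_words_def by blast
    hence "2 ^ n * word_weight u \<le> 2 ^ n * 3" by (auto split: if_splits)
    hence "word_weight u \<le> 3" by (simp only: mult_le_cancel1) simp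
    hence "u \<in> ?W" using F(2) len[of u] by auto
    thus "F \<in> (\<lambda>(e, u). tail_word n e u) ` (UNIV \<times> ?W)" unfolding F(1) by blast
  qed
  hence "card (tail_words n (2 * 2 ^ n) :: ('k grassmann \<Rightarrow> _) set) \<le> card ((UNIV :: bool set) \<times> ?W)"
    by (intro surj_card_le finite_cartesian_product finite_lists_length_le) auto
  also have "\<dots> = 30"
    by (subst card_cartesian_product, subst card_lists_length_le) (simp_all add: card_UNIV_bool numeral_eq_Suc)
  finally show ?thesis .
qed

lemma weight_growth_le_power:
  assumes "m \<le> 2 ^ j"
  shows "weight_growth {0, 1} pivot_weight (pivot :: nat \<Rightarrow> 'k::field grassmann \<Rightarrow> _) m \<le> 30 * 4 ^ j"
proof -
  have "2 ^ (0 + j) + m \<le> 2 * 2 ^ j + 2 ^ 0" using assms by simp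
  from tail_words_spanning_set[OF this] obtain T :: "('k grassmann \<Rightarrow> 'k grassmann) set" where T: "finite T"
    "card T \<le> 4 ^ j * card (tail_words j (2 * 2 ^ j) :: ('k grassmann \<Rightarrow> _) set)"
    "tail_words 0 m \<subseteq> endo.span T" by auto
  have "{monomial pivot w | w. w \<in> lists {0, 1} \<and> w \<noteq> [] \<and> word_weight w \<le> m} \<subseteq> (tail_words 0 m :: ('k grassmann \<Rightarrow> _) set)"
  proof
    fix F :: "'k grassmann \<Rightarrow> 'k grassmann"
    assume "F \<in> {monomial pivot w | w. w \<in> lists {0, 1} \<and> w \<noteq> [] \<and> word_weight w \<le> m}"
    then obtain w where w: "F = monomial pivot w" "w \<in> lists {0, 1}" "word_weight w \<le> m" by blast
    hence "F = tail_word 0 False w" by (simp add: tail_word_def gen_pow_def)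
    thus "F \<in> tail_words 0 m" using w(2,3) unfolding tail_words_def by fastforce
  qed
  with T(3) have "weight_growth {0, 1} pivot_weight (pivot :: nat \<Rightarrow> 'k grassmann \<Rightarrow> _) m \<le> card T"
    unfolding weight_growth_def using T(1)
    by (intro endo.dim_le_card endo.span_minimal endo.subspace_span) blast+
  also have "\<dots> \<le> 4 ^ j * 30"
    using T(2) card_tail_words_le[where 'k = 'k and n = j] by (meson le_trans mult_le_mono2)
  finally show ?thesis by simp
qed

section \<open>Quadratic growth\<close>

lemma (in vector_space) dim_mono_finite:
  assumes "S \<subseteq> T" "finite T"
  shows "dim (span S) \<le> dim (span T)"
proof -
  obtain B where "B \<subseteq> T" "independent B" "T \<subseteq> span B" "card B = dim T"
    by (rule basis_exists)
  thus ?thesis using assms dim_le_card[of S B] finite_subset[of B T] by simp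
qed

lemma weight_growth_mono:
  assumes "a \<le> b"
  shows "weight_growth {0, 1} pivot_weight (pivot :: nat \<Rightarrow> 'k::field grassmann \<Rightarrow> _) a
    \<le> weight_growth {0, 1} pivot_weight (pivot :: nat \<Rightarrow> 'k grassmann \<Rightarrow> _) b"
  unfolding weight_growth_def
  by (rule endo.dim_mono_finite[OF _ finite_wspan_monomials]) (use assms in auto)

text \<open>This serves m < 4, where no 2^(k+2) fits below m. The operator v_0 is nonzero as it maps
  x_0 to 1.\<close>

lemma weight_growth_pos:
  assumes "m \<ge> 1"
  shows "weight_growth {0, 1} pivot_weight (pivot :: nat \<Rightarrow> 'k::field grassmann \<Rightarrow> _) m \<ge> 1"
proof -
  have "pivot 0 (gen 0) = (1 :: 'k grassmann)"
    using pivot_gen_mult_self[of 0 "1 :: 'k grassmann"] by (simp add: pivot_one)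
  moreover have "(pivot 0 :: 'k grassmann \<Rightarrow> _) \<in> wspan m"
    using pivot_in_wspan[of 0] wspan_mono[OF assms] by auto
  ultimately have "card {()} \<le> endo.dim (wspan m :: ('k grassmann \<Rightarrow> _) set)"
    unfolding wspan_def
  proof (intro endo.card_le_dim_span[where \<phi> = "\<lambda>_. pivot 0"])
    fix c :: "unit \<Rightarrow> 'k" and i
    assume v: "pivot 0 (gen 0) = (1 :: 'k grassmann)"
      and "(\<Sum>i\<in>{()}. escale (c i) (pivot 0)) = 0"
    moreover have "(pivot 0 :: 'k grassmann \<Rightarrow> _) \<noteq> 0" using v by (metis zero_fun_apply zero_neq_one)
    ultimately show "c i = 0" by simp
  qed (simp_all add: finite_wspan_monomials[simplified])
  thus ?thesis by (simp add: weight_growth_pivot[simplified])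
qed

lemma weight_growth_bounds:
  assumes "m \<ge> 1"
  shows "m\<^sup>2 \<le> 64 * weight_growth {0, 1} pivot_weight (pivot :: nat \<Rightarrow> 'k::field grassmann \<Rightarrow> _) m" (is "_ \<le> 64 * ?g m")
    and "weight_growth {0, 1} pivot_weight (pivot :: nat \<Rightarrow> 'k grassmann \<Rightarrow> _) m \<le> 120 * m\<^sup>2"
proof -
  \<comment> \<open>Dyadic comparison: the lower bound uses k = n - 2, which gives 64 = (2^3)^2; the
    upper one uses j = n + 1, which gives 30 * 4 = 120.\<close>
  obtain n where n: "2 ^ n \<le> m" "m < 2 ^ (n + 1)"
    using ex_power_ivl1[of 2 m] assms by auto
  have sq: "(4 :: nat) ^ j = (2 ^ j)\<^sup>2" for j by (simp add: power2_eq_square flip: power_mult_distrib)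
  show "m\<^sup>2 \<le> 64 * ?g m"
  proof (cases "n \<ge> 2")
    case True
    then obtain k where k: "n = k + 2" by (metis add.commute le_Suc_ex)
    have "m\<^sup>2 \<le> (2 ^ (n + 1))\<^sup>2" using n by (intro power_mono) simp_all
    also have "\<dots> = 64 * 4 ^ k" by (simp add: sq k power_mult_distrib)
    also have "4 ^ k \<le> ?g (2 ^ (k + 2))" by (rule weight_growth_ge_power)
    also have "\<dots> \<le> ?g m" using n k by (intro weight_growth_mono) simp
    finally show ?thesis by simp
  next
    case False
    hence "2 ^ (n + 1) \<le> (2 ^ 2 :: nat)" by (intro power_increasing) simp_all
    with n have "m\<^sup>2 \<le> 4\<^sup>2" by (intro power_mono) simp_all
    with weight_growth_pos[OF assms, where 'k = 'k] show ?thesis by simp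
  qed
  have "?g m \<le> 30 * 4 ^ (n + 1)" using n by (intro weight_growth_le_power) simp
  also have "\<dots> = 120 * (2 ^ n)\<^sup>2" by (simp add: sq)
  also have "\<dots> \<le> 120 * m\<^sup>2" using n by (intro mult_left_mono power_mono) simp_all
  finally show "?g m \<le> 120 * m\<^sup>2" .
qed

text \<open>Each letter has weight 1 or 2, so length \<le> weight \<le> 2 * length.\<close>

lemma growth_bounds:
  shows "weight_growth {0, 1} pivot_weight (pivot :: nat \<Rightarrow> 'k::field grassmann \<Rightarrow> _) m
      \<le> growth {0, 1} (pivot :: nat \<Rightarrow> 'k grassmann \<Rightarrow> _) m"
    and "growth {0, 1} (pivot :: nat \<Rightarrow> 'k grassmann \<Rightarrow> _) m
      \<le> weight_growth {0, 1} pivot_weight (pivot :: nat \<Rightarrow> 'k grassmann \<Rightarrow> _) (2 * m)"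
proof -
  let ?W = "\<lambda>m. {monomial pivot w :: 'k grassmann \<Rightarrow> _ | w. w \<in> lists {0, 1} \<and> w \<noteq> [] \<and> word_weight w \<le> m}"
  let ?L = "{monomial pivot w :: 'k grassmann \<Rightarrow> _ | w. w \<in> lists {0, 1} \<and> w \<noteq> [] \<and> length w \<le> m}"
  have len: "length w \<le> word_weight w" "word_weight w \<le> 2 * length w" for w
    by (induction w) (auto simp: pivot_weight_def)
  have "?W m \<subseteq> ?L" using len(1) by (blast intro: order_trans)
  moreover have "word_weight w \<le> 2 * m" if "length w \<le> m" for w using len(2)[of w] that by linarith
  hence sub: "?L \<subseteq> ?W (2 * m)" by blast
  moreover have "finite ?L" using sub finite_wspan_monomials by (rule finite_subset)
  ultimately show "weight_growth {0, 1} pivot_weight (pivot :: nat \<Rightarrow> 'k grassmann \<Rightarrow> _) m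
      \<le> growth {0, 1} (pivot :: nat \<Rightarrow> 'k grassmann \<Rightarrow> _) m"
    "growth {0, 1} (pivot :: nat \<Rightarrow> 'k grassmann \<Rightarrow> _) m
      \<le> weight_growth {0, 1} pivot_weight (pivot :: nat \<Rightarrow> 'k grassmann \<Rightarrow> _) (2 * m)"
    unfolding growth_def weight_growth_def
    using endo.dim_mono_finite finite_wspan_monomials by blast+
qed

section \<open>From two-sided polynomial bounds to the Gelfand-Kirillov dimension\<close>

lemma ln_quotient_tendsto:
  fixes g :: "nat \<Rightarrow> real" and d :: nat
  assumes "c > 0" "C > 0" and bounds: "\<And>n. n \<ge> 1 \<Longrightarrow> c * real n ^ d \<le> g n \<and> g n \<le> C * real n ^ d"
  shows "(\<lambda>n. ln (g n) / ln (real n)) \<longlonglongrightarrow> real d"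
proof -
  have lim: "(\<lambda>n. ln b / ln (real n) + real d) \<longlonglongrightarrow> real d" for b :: real
  proof -
    have "filterlim (\<lambda>n. ln (real n)) at_top sequentially"
      by (rule filterlim_compose[OF ln_at_top filterlim_real_sequentially])
    hence "(\<lambda>n. ln b / ln (real n)) \<longlonglongrightarrow> 0"
      by (intro real_tendsto_divide_at_top[OF tendsto_const])
    from tendsto_add[OF this tendsto_const[of "real d"]] show ?thesis by simp
  qed
  have ln_eq: "ln b / ln (real n) + real d = ln (b * real n ^ d) / ln (real n)" if "b > 0" "n \<ge> 2" for b n
    using that by (simp add: ln_mult ln_realpow add_divide_distrib)
  \<comment> \<open>The constants contribute only ln c / ln n and ln C / ln n, which tend to 0; n
    \<ge> 2 makes ln n positive.\<close>
  show ?thesis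
  proof (rule tendsto_sandwich[OF _ _ lim[of c] lim[of C]])
    show "eventually (\<lambda>n. ln c / ln (real n) + real d \<le> ln (g n) / ln (real n)) sequentially"
      using eventually_ge_at_top[of 2]
    proof eventually_elim
      case (elim n)
      have "0 < c * real n ^ d" "c * real n ^ d \<le> g n" using elim \<open>c > 0\<close> bounds[of n] by simp_all
      hence "ln (c * real n ^ d) \<le> ln (g n)" by simp
      thus ?case using elim \<open>c > 0\<close> by (simp only: ln_eq) (intro divide_right_mono, simp_all)
    qed
    show "eventually (\<lambda>n. ln (g n) / ln (real n) \<le> ln C / ln (real n) + real d) sequentially"
      using eventually_ge_at_top[of 2]
    proof eventually_elim
      case (elim n)
      have "0 < c * real n ^ d" "c * real n ^ d \<le> g n" "g n \<le> C * real n ^ d"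
        using elim \<open>c > 0\<close> bounds[of n] by simp_all
      hence "ln (g n) \<le> ln (C * real n ^ d)" by simp
      thus ?case using elim \<open>C > 0\<close> by (simp only: ln_eq) (intro divide_right_mono, simp_all)
    qed
  qed
qed

theorem theorem9p4:
  fixes v :: "nat \<Rightarrow> 'k::field grassmann \<Rightarrow> 'k grassmann"
  defines "v \<equiv> pivot"
  shows
    "(\<exists>c1 c2 c3 c4 :: real. c1 > 0 \<and> c2 > 0 \<and> c3 > 0 \<and> c4 > 0 \<and>
        (\<forall>m\<ge>1. c1 * (real m)\<^sup>2 \<le> real (weight_growth {0, 1} pivot_weight v m) \<and>
               real (weight_growth {0, 1} pivot_weight v m) \<le> c2 * (real m)\<^sup>2) \<and>
        (\<forall>m\<ge>1. c3 * (real m)\<^sup>2 \<le> real (growth {0, 1} v m) \<and>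
               real (growth {0, 1} v m) \<le> c4 * (real m)\<^sup>2)) \<and>
     GKdim {0, 1} v = 2 \<and> lower_GKdim {0, 1} v = 2"
proof -
  define wg where "wg = weight_growth {0, 1} pivot_weight v"
  define gr where "gr = growth {0, 1} v"
  have wg: "1 / 64 * (real m)\<^sup>2 \<le> real (wg m)" "real (wg m) \<le> 120 * (real m)\<^sup>2" if "m \<ge> 1" for m
  proof -
    have "real (m\<^sup>2) \<le> real (64 * wg m)" "real (wg m) \<le> real (120 * m\<^sup>2)"
      unfolding wg_def v_def using weight_growth_bounds[OF that, where 'k = 'k] by (simp_all only: of_nat_le_iff)
    thus "1 / 64 * (real m)\<^sup>2 \<le> real (wg m)" "real (wg m) \<le> 120 * (real m)\<^sup>2" by simp_all
  qed
  have gr: "1 / 64 * (real m)\<^sup>2 \<le> real (gr m) \<and> real (gr m) \<le> 480 * (real m)\<^sup>2" if "m \<ge> 1" for m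
  proof -
    have "wg m \<le> gr m" "gr m \<le> wg (2 * m)"
      unfolding wg_def gr_def v_def by (rule growth_bounds)+
    \<comment> \<open>Doubling the argument multiplies the upper constant by 4: 480 = 120 *
      2^2.\<close>
    thus ?thesis using wg[of m] wg(2)[of "2 * m"] that by (auto simp: power_mult_distrib)
  qed
  have "(\<lambda>n. ln (real (gr n)) / ln (real n)) \<longlonglongrightarrow> real 2"
    using gr by (intro ln_quotient_tendsto[of "1 / 64" 480]) auto
  hence lim: "(\<lambda>n. ereal (ln (real (gr n)) / ln (real n))) \<longlonglongrightarrow> 2"
    by (simp add: numeral_eq_ereal)
  have "GKdim {0, 1} v = 2" "lower_GKdim {0, 1} v = 2"
    unfolding GKdim_def lower_GKdim_def gr_def[symmetric]
    using lim by (auto intro: lim_imp_Limsup lim_imp_Liminf)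
  moreover have "\<exists>c1 c2 c3 c4 :: real. c1 > 0 \<and> c2 > 0 \<and> c3 > 0 \<and> c4 > 0 \<and>
      (\<forall>m\<ge>1. c1 * (real m)\<^sup>2 \<le> real (wg m) \<and> real (wg m) \<le> c2 * (real m)\<^sup>2) \<and>
      (\<forall>m\<ge>1. c3 * (real m)\<^sup>2 \<le> real (gr m) \<and> real (gr m) \<le> c4 * (real m)\<^sup>2)"
    using wg gr by (intro exI[of _ "1 / 64"] exI[of _ 120] exI[of _ "1 / 64"] exI[of _ 480]) simp
  ultimately show ?thesis unfolding wg_def gr_def by blast
qed

end
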